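(* Let $(a_n)_{n\ge0}$ be integers with $0\le a_n\le a_{n+1}\le a_n+1$ for all $n$ and $a_n\to\infty$. Let $(Z_n:n\in\mathbb N)$ be the aging branching process (without immigration) with maximal ages $(a_n)$ and reproduction law $R$, where $m=\mathbf E(R)>0$ and $\sigma^2=\mathbf E[(R-m)^2]<\infty$. Let $\mathrm{Nonext}=\{\forall n\ge0: Z_n>0\}$. Then: (i) The event $\mathrm{Nonext}$ has positive probability. (ii) The process $(Z_n/\mathbf E(Z_n):n\in\mathbb N)$ converges a.s. and in $L^2$ to a non-negative random variable $W$, which is positive a.s. on $\mathrm{Nonext}$. (iii) For each $a\in\mathbb N$, the process $(Z_n(a)/Z_n:n\in\mathbb N)$ converges a.s. to $m/(m+1)^{a+1}$ on $\mathrm{Nonext}$.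
   Context: $\mathbb N=\{0,1,2,\dots\}$. $R$ is a random variable with values in $\mathbb N$. $Z_n(a)$ is the number of individuals of age $a$ in generation $n$: $Z_0(0)=1$, $Z_0(a)=0$ for $a\ge1$ (so $Z_0=1$), and for $n\ge1$, $Z_n(a)=Z_{n-1}(a-1)\mathbf 1_{\{a\le a_n\}}$ for $a\ge1$; $Z_n(0)=\sum_{j=1}^{Z_{n-1}}R_{j,n}$; $Z_n=\sum_{a=0}^{a_n}Z_n(a)$, where $(R_{j,n})_{j,n}$ are i.i.d. copies of $R$. *)

theory Defs
  imports "HOL-Probability.Probability"
begin

text \<open>
  Realisation-wise dynamics: \<open>a n\<close> is the maximal age in generation \<open>n\<close>, and \<open>r j n\<close> (used only for
  \<open>j \<ge> 1\<close>, \<open>n \<ge> 1\<close>) is the number of children, born into generation \<open>n\<close>, of the \<open>j\<close>-th individual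
  alive in generation \<open>n - 1\<close>. \<open>aging_age a r n k\<close> is \<open>Z\<^sub>n(k)\<close>. The upper summation limit in the
  successor equation is \<open>Z\<^sub>n\<close> written out; see \<open>aging_total\<close>.
\<close>

primrec aging_age :: "(nat \<Rightarrow> nat) \<Rightarrow> (nat \<Rightarrow> nat \<Rightarrow> nat) \<Rightarrow> nat \<Rightarrow> nat \<Rightarrow> nat" where
  "aging_age a r 0 = (\<lambda>k. if k = 0 then 1 else 0)"
| "aging_age a r (Suc n) =
     (\<lambda>k. case k of
            0 \<Rightarrow> (\<Sum>j = 1..(\<Sum>b = 0..a n. aging_age a r n b). r j (Suc n))
          | Suc b \<Rightarrow> (if Suc b \<le> a (Suc n) then aging_age a r n b else 0))"

definition aging_total :: "(nat \<Rightarrow> nat) \<Rightarrow> (nat \<Rightarrow> nat \<Rightarrow> nat) \<Rightarrow> nat \<Rightarrow> nat" where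
  "aging_total a r n = (\<Sum>k = 0..a n. aging_age a r n k)"

lemma aging_age_newborn:
  "aging_age a r (Suc n) 0 = (\<Sum>j = 1..aging_total a r n. r j (Suc n))"
  by (simp add: aging_total_def)

lemma aging_age_older:
  "aging_age a r (Suc n) (Suc k) = aging_age a r n k * (if Suc k \<le> a (Suc n) then 1 else 0)"
  by simp

definition aging_Z_age ::
    "(nat \<Rightarrow> nat) \<Rightarrow> (nat \<Rightarrow> nat \<Rightarrow> 'w \<Rightarrow> nat) \<Rightarrow> nat \<Rightarrow> nat \<Rightarrow> 'w \<Rightarrow> nat" where
  "aging_Z_age a X n k \<omega> = aging_age a (\<lambda>j i. X j i \<omega>) n k"

definition aging_Z :: "(nat \<Rightarrow> nat) \<Rightarrow> (nat \<Rightarrow> nat \<Rightarrow> 'w \<Rightarrow> nat) \<Rightarrow> nat \<Rightarrow> 'w \<Rightarrow> nat" where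
  "aging_Z a X n \<omega> = aging_total a (\<lambda>j i. X j i \<omega>) n"

definition Nonext ::
    "'w measure \<Rightarrow> (nat \<Rightarrow> nat) \<Rightarrow> (nat \<Rightarrow> nat \<Rightarrow> 'w \<Rightarrow> nat) \<Rightarrow> 'w set" where
  "Nonext M a X = {\<omega> \<in> space M. \<forall>n. aging_Z a X n \<omega> > 0}"

text \<open>
  Square integrability is required explicitly because the Bochner integral of a non-integrable
  function is 0 by convention.
\<close>

definition converges_L2 :: "'w measure \<Rightarrow> (nat \<Rightarrow> 'w \<Rightarrow> real) \<Rightarrow> ('w \<Rightarrow> real) \<Rightarrow> bool" where
  "converges_L2 M Y W \<longleftrightarrow>
     (\<forall>n. Y n \<in> borel_measurable M \<and> integrable M (\<lambda>\<omega>. (Y n \<omega>)\<^sup>2)) \<and>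
     W \<in> borel_measurable M \<and> integrable M (\<lambda>\<omega>. (W \<omega>)\<^sup>2) \<and>
     (\<lambda>n. \<integral>\<omega>. (Y n \<omega> - W \<omega>)\<^sup>2 \<partial>M) \<longlonglongrightarrow> 0"

end

theory Submission
  imports Defs
begin

text \<open>
  Write \<open>B\<^sub>i\<close> for the number of newborns of generation \<open>i\<close>, with \<open>B\<^sub>0 = 1\<close> for the founder. The
  maximal age grows by at most one per generation, so a cohort that is young enough now was
  never too old before, and \<open>Z\<^sub>n\<close> is the sum of the births \<open>B\<^sub>i\<close> over the window from \<open>n - a\<^sub>n\<close>
  to \<open>n\<close>. Given the past, \<open>B\<^sub>n\<^sub>+\<^sub>1 = m Z\<^sub>n + \<xi>\<^sub>n\<^sub>+\<^sub>1\<close> with a centred noise \<open>\<xi>\<^sub>n\<^sub>+\<^sub>1\<close> of variance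
  \<open>\<sigma>\<^sup>2 Z\<^sub>n\<close>. The process is therefore a deterministic linear recursion driven by noise, and the
  mean \<open>e\<^sub>n\<close> of \<open>Z\<^sub>n\<close> solves the same recursion without noise. The ratio \<open>Z\<^sub>n / e\<^sub>n\<close> is not a
  martingale; the recursion is studied directly instead.

  \<^emph>\<open>Linear recursion.\<close> Without deaths one would have \<open>e\<^sub>n\<^sub>+\<^sub>1 = (1 + m) e\<^sub>n\<close>. The individuals
  that die in one step were born \<open>a\<^sub>n\<close> generations earlier, and the population grows
  exponentially as soon as it is allowed to live long enough (\<open>growth\<close>), so the proportion lost
  is at most of order \<open>\<rho>\<close> to the power \<open>- a\<^sub>n\<close> for some \<open>\<rho> > 1\<close>. As \<open>a\<^sub>n\<close> may grow arbitrarily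
  slowly these losses need not be summable. But the mean suffers them as well: in the increments
  of \<open>Z\<^sub>n / e\<^sub>n\<close> the loss is multiplied by the difference between the ratio now and the ratio
  \<open>a\<^sub>n\<close> generations ago (\<open>ratio_increment\<close>). This is a contraction once \<open>a\<^sub>n\<close> is large, and if
  the noise is exponentially small relative to the population then the increments decay
  exponentially (\<open>ratio_converges\<close>). The limit is positive when the population survives
  (\<open>ratio_positive\<close>), because the birth ratios \<open>B\<^sub>n\<^sub>+\<^sub>1\<close> over their mean are, up to a summable
  relative error, averages of earlier birth ratios.

  \<^emph>\<open>Almost sure control of the noise.\<close> A population of size \<open>z\<close> produces noise of order \<open>\<surd>z\<close>,
  and a generation is called calm if its noise is at most \<open>m/2\<close> times \<open>z\<close> to the power \<open>3/4\<close>.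
  Calm populations grow exponentially, and by Chebyshev a large population stays calm forever
  with probability at least one half (\<open>stay_calm\<close>). From every surviving history of a late
  enough generation a large size is reached with probability bounded below: it is enough that
  the first individual has children in each of the next \<open>K\<close> generations, in which none of those
  children dies (\<open>fertile_run\<close>). An event that keeps a conditional probability bounded below,
  whatever the past, has probability one; so almost surely all but finitely many generations are
  calm (\<open>AE_eventually_calm\<close>), and the deterministic statements apply path by path. They give
  the almost sure limit \<open>W\<close>, its positivity on survival and the age profile.

  \<^emph>\<open>Convergence in quadratic mean.\<close> By superposition \<open>Z\<^sub>n / e\<^sub>n - 1\<close> is a sum of orthogonal
  noise terms weighted by the share that a single newborn of generation \<open>i\<close> contributes to the
  mean at time \<open>n\<close>. These shares converge, are bounded by \<open>1 / (m e\<^sub>i\<^sub>-\<^sub>1)\<close>, and \<open>1 / e\<^sub>i\<close> is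
  summable; dominated convergence of the series gives convergence in quadratic mean. Hence \<open>W\<close>
  has mean one and cannot vanish almost surely, which makes survival possible.
\<close>

section \<open>Linear dynamics of births\<close>

text \<open>
  Size at time \<open>n\<close> of the population whose births are \<open>\<beta>\<close>. Truncated subtraction makes the
  window start at \<open>0\<close> as long as \<open>a n \<ge> n\<close>, when nobody has died yet.
\<close>

definition alive :: "(nat \<Rightarrow> nat) \<Rightarrow> (nat \<Rightarrow> real) \<Rightarrow> nat \<Rightarrow> real" where
  "alive a \<beta> n = (\<Sum>i\<in>{n - a n..n}. \<beta> i)"

text \<open>
  Mean number of births at time \<open>n\<close> among the descendants of one individual born at time \<open>i\<close>,
  that individual included: the Green function of the recursion \<open>\<beta>\<^sub>n\<^sub>+\<^sub>1 = m z\<^sub>n\<close> with a unit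
  source at \<open>i\<close>.
\<close>

fun response :: "(nat \<Rightarrow> nat) \<Rightarrow> real \<Rightarrow> nat \<Rightarrow> nat \<Rightarrow> real" where
  "response a m i 0 = of_bool (i = 0)"
| "response a m i (Suc n) = of_bool (i = Suc n) + m * (\<Sum>j\<in>{n - a n..n}. response a m i j)"

declare response.simps(2) [simp del]

lemma response_Suc: "response a m i (Suc n) = of_bool (i = Suc n) + m * alive a (response a m i) n"
  by (simp add: response.simps(2) alive_def)

lemma response_before: "n < i \<Longrightarrow> response a m i n = 0"
proof (induction n rule: less_induct)
  case (less n)
  then show ?case
    by (cases n) (auto simp: response_Suc alive_def intro!: sum.neutral)
qed

text \<open>
  The recursion is linear, so births driven by an arbitrary source \<open>s\<close> are the superposition of
  the responses to its unit parts. The bound \<open>L\<close> on the time is free because responses vanish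
  before their source; two times can then be compared over one index set.
\<close>

lemma superposition:
  assumes "\<beta> 0 = s 0" "\<And>n. \<beta> (Suc n) = m * alive a \<beta> n + s (Suc n)" "n \<le> L"
  shows "\<beta> n = (\<Sum>i\<le>L. s i * response a m i n)"
  using assms(3)
proof (induction n rule: less_induct)
  case (less n)
  show ?case
  proof (cases n)
    case 0
    then show ?thesis
      using assms(1) by (simp add: if_distrib of_bool_def sum.delta cong: if_cong)
  next
    case (Suc k)
    have "alive a \<beta> k = (\<Sum>j\<in>{k - a k..k}. \<Sum>i\<le>L. s i * response a m i j)"
      unfolding alive_def using less Suc by (intro sum.cong) auto
    also have "\<dots> = (\<Sum>i\<le>L. s i * alive a (response a m i) k)"
      unfolding alive_def by (subst sum.swap) (simp add: sum_distrib_left)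
    finally have "\<beta> n = (\<Sum>i\<le>L. s i * (m * alive a (response a m i) k)) + s n"
      using assms(2)[of k] Suc by (simp add: sum_distrib_left mult_ac)
    also have "s n = (\<Sum>i\<le>L. s i * of_bool (i = Suc k))"
      using less.prems Suc by (simp add: of_bool_def if_distrib sum.delta cong: if_cong)
    finally show ?thesis
      using Suc by (simp add: response_Suc algebra_simps sum.distrib)
  qed
qed

lemma alive_superposition:
  assumes "\<beta> 0 = s 0" "\<And>n. \<beta> (Suc n) = m * alive a \<beta> n + s (Suc n)" "n \<le> L"
  shows "alive a \<beta> n = (\<Sum>i\<le>L. s i * alive a (response a m i) n)"
proof -
  have "alive a \<beta> n = (\<Sum>j\<in>{n - a n..n}. \<Sum>i\<le>L. s i * response a m i j)"
    unfolding alive_def using assms superposition[of \<beta> s m a] by (intro sum.cong) auto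
  also have "\<dots> = (\<Sum>i\<le>L. s i * alive a (response a m i) n)"
    unfolding alive_def by (subst sum.swap) (simp add: sum_distrib_left)
  finally show ?thesis .
qed

locale maximal_ages =
  fixes a :: "nat \<Rightarrow> nat" and m :: real
  assumes age_step: "\<And>n. a n \<le> a (Suc n) \<and> a (Suc n) \<le> a n + 1"
    and age_lim: "filterlim a at_top sequentially"
    and m_pos: "m > 0"
begin

definition mean_births :: "nat \<Rightarrow> real" where "mean_births = response a m 0"
definition mean_size :: "nat \<Rightarrow> real" where "mean_size n = alive a mean_births n"

lemma mean_births_0 [simp]: "mean_births 0 = 1" by (simp add: mean_births_def)
lemma mean_births_Suc: "mean_births (Suc n) = m * mean_size n" by (simp add: mean_births_def mean_size_def response_Suc)

text \<open>
  The window of birth times moves its left end exactly when the maximal age stays put and the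
  oldest possible cohort exists.
\<close>

lemma alive_Suc:
  "alive a \<beta> (Suc n) = alive a \<beta> n + \<beta> (Suc n)
     - (if a (Suc n) = a n \<and> a n \<le> n then \<beta> (n - a n) else 0)"
proof -
  consider "a (Suc n) = Suc (a n)" | "a (Suc n) = a n" "a n \<le> n" | "a (Suc n) = a n" "n < a n"
    using age_step[of n] by linarith
  then show ?thesis
  proof cases
    case 1
    then show ?thesis unfolding alive_def by (simp add: atLeastAtMostSuc_conv)
  next
    case 2
    then have "{Suc n - a (Suc n)..Suc n} = insert (Suc n) {Suc (n - a n)..n}"
      "{n - a n..n} = insert (n - a n) {Suc (n - a n)..n}" by auto
    then show ?thesis unfolding alive_def using 2 by simp
  next
    case 3
    then have "Suc n - a n = n - a n" by simp
    then show ?thesis unfolding alive_def using 3 by (simp add: atLeastAtMostSuc_conv)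
  qed
qed

lemma alive_nonneg: "(\<And>i. 0 \<le> \<beta> i) \<Longrightarrow> 0 \<le> alive a \<beta> n"
  by (simp add: alive_def sum_nonneg)

lemma birth_le_alive:
  assumes "\<And>i. 0 \<le> \<beta> i" "i \<le> n" "n \<le> i + a n" shows "\<beta> i \<le> alive a \<beta> n"
  unfolding alive_def using assms by (intro member_le_sum) auto

lemma mean_births_pos: "mean_births n > 0" and mean_size_pos: "mean_size n > 0"
proof -
  have *: "mean_births n > 0" for n
  proof (induction n rule: less_induct)
    case (less n)
    show ?case
    proof (cases n)
      case (Suc k)
      have "mean_size k > 0" unfolding mean_size_def alive_def using less Suc by (intro sum_pos) auto
      then show ?thesis using Suc m_pos by (simp add: mean_births_Suc)
    qed simp
  qed
  show "mean_births n > 0" by fact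
  show "mean_size n > 0" unfolding mean_size_def alive_def using * by (intro sum_pos) auto
qed

lemma response_nonneg: "0 \<le> response a m i n"
proof (induction n rule: less_induct)
  case (less n)
  then show ?case
    using m_pos by (cases n) (auto simp: response_Suc alive_def intro!: add_nonneg_nonneg mult_nonneg_nonneg sum_nonneg)
qed

text \<open>
  The mean population contains \<open>mean_births i\<close> newborns at time \<open>i\<close>, each with the same mean
  progeny, and other individuals besides.
\<close>

lemma response_le: "mean_births i * response a m i n \<le> mean_births n"
proof (induction n rule: less_induct)
  case (less n)
  show ?case
  proof (cases "n \<le> i")
    case True
    then show ?thesis
    proof (cases "n = i")
      case True
      have "response a m i i = 1"
      proof (cases i)
        case (Suc k)
        have "alive a (response a m i) k = 0"
          unfolding alive_def using Suc by (intro sum.neutral) (auto simp: response_before)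
        then show ?thesis by (metis Suc mult_zero_right add_0_right of_bool_eq(2) response_Suc)
      qed simp
      then show ?thesis using True by simp
    next
      case False
      then show ?thesis using True mean_births_pos[of n] by (simp add: response_before)
    qed
  next
    case False
    then obtain k where k: "n = Suc k" "i \<noteq> Suc k" by (cases n) auto
    have "mean_births i * alive a (response a m i) k \<le> mean_size k"
      unfolding mean_size_def alive_def sum_distrib_left using less k by (intro sum_mono) auto
    then show ?thesis using k m_pos by (simp add: response_Suc mean_births_Suc mult.left_commute)
  qed
qed

lemma alive_response_le: "mean_births i * alive a (response a m i) n \<le> mean_size n"
  unfolding mean_size_def alive_def sum_distrib_left by (intro sum_mono response_le)

section \<open>Exponential growth\<close>

lemma eventually_age_ge: "\<exists>n0. \<forall>n\<ge>n0. K \<le> a n"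
  using age_lim by (auto simp: filterlim_at_top eventually_sequentially)

text \<open>
  If every generation has at least \<open>c\<close> times as many children as the population has members,
  then the population grows exponentially, since individuals who live for \<open>A\<close> generations with
  \<open>c A \<ge> 2\<close> at least double their number in that time. The constants depend on \<open>c\<close> and \<open>a\<close>
  only, not on the births or the starting time \<open>N\<close>: early generations with a small maximal age
  cost at most a bounded factor. The hypothesis is confined to the generations before \<open>n\<close>, so
  that it can be used up to a first exception.
\<close>

lemma growth:
  assumes c: "c > 0"
  obtains \<rho> \<kappa> :: real where "\<rho> > 1" "\<kappa> > 0"
    "\<And>\<beta> N n. (\<And>i. 0 \<le> \<beta> i) \<Longrightarrow> N \<le> n \<Longrightarrow> (\<And>i. N \<le> i \<Longrightarrow> i < n \<Longrightarrow> c * alive a \<beta> i \<le> \<beta> (Suc i))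
       \<Longrightarrow> \<kappa> * \<rho> ^ (n - N) * alive a \<beta> N \<le> alive a \<beta> n"
proof -
  obtain A :: nat where A: "2 \<le> c * real A" "A > 0"
  proof -
    obtain A :: nat where "2 / c < A" using reals_Archimedean2 by blast
    then have "2 < c * real A" using c by (simp add: field_simps)
    moreover from this have "A > 0" by (intro gr0I) auto
    ultimately show ?thesis using that[of A] by simp
  qed
  obtain n0 where n0: "\<And>n. n \<ge> n0 \<Longrightarrow> A \<le> a n" using eventually_age_ge by blast
  define \<rho> where "\<rho> = root A 2"
  have \<rho>: "\<rho> > 1" "\<rho> ^ A = 2" using A by (auto simp: \<rho>_def)
  define q where "q = min 1 c"
  have q: "0 < q" "q \<le> 1" "q \<le> c" using c by (auto simp: q_def)
  (* The factor q/2 pays for the first A steps after the start, where the initial population may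
     have died out and only its first children count; the rest pays for the times before n0. *)
  define \<kappa> where "\<kappa> = q / 2 * q ^ n0 / \<rho> ^ n0"
  have \<kappa>: "\<kappa> > 0" using q \<rho> by (auto simp: \<kappa>_def)
  have main: "q / 2 * \<rho> ^ (n - N) * alive a \<beta> N \<le> alive a \<beta> n"
    if nn: "\<And>i. 0 \<le> \<beta> i" and "n0 \<le> N" "N \<le> n"
      and births: "\<And>i. N \<le> i \<Longrightarrow> i < n \<Longrightarrow> c * alive a \<beta> i \<le> \<beta> (Suc i)" for \<beta> N n
    using \<open>N \<le> n\<close> births
  proof (induction n rule: less_induct)
    case (less n)
    note z0 = alive_nonneg[of \<beta> N, OF nn]
    consider "n = N" | "N < n" "n \<le> N + A" | "N + A < n" using less.prems by linarith
    then show ?case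
    proof cases
      case 1
      have "q / 2 * alive a \<beta> N \<le> 1 * alive a \<beta> N" using q z0 by (intro mult_right_mono) auto
      then show ?thesis using 1 by simp
    next
      case 2
      have "\<rho> ^ (n - N) \<le> \<rho> ^ A" using 2 \<rho> by (intro power_increasing) auto
      then have "q / 2 * \<rho> ^ (n - N) \<le> q / 2 * 2" using q \<rho> by (intro mult_left_mono) auto
      then have "q / 2 * \<rho> ^ (n - N) \<le> c" using q by linarith
      then have "q / 2 * \<rho> ^ (n - N) * alive a \<beta> N \<le> c * alive a \<beta> N"
        using z0 by (rule mult_right_mono)
      also have "\<dots> \<le> \<beta> (Suc N)" using less.prems 2 by auto
      also have "\<dots> \<le> alive a \<beta> n"
        using 2 n0[of n] that by (intro birth_le_alive nn) auto
      finally show ?thesis .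
    next
      case 3
      have IH: "q / 2 * \<rho> ^ (n - A - N) * alive a \<beta> N \<le> alive a \<beta> i" if i: "i \<in> {n - A..<n}" for i
      proof -
        have "\<rho> ^ (n - A - N) \<le> \<rho> ^ (i - N)" using i 3 \<rho> by (intro power_increasing) auto
        then have "q / 2 * \<rho> ^ (n - A - N) * alive a \<beta> N \<le> q / 2 * \<rho> ^ (i - N) * alive a \<beta> N"
          using q z0 by (intro mult_right_mono mult_left_mono) auto
        also have "\<dots> \<le> alive a \<beta> i" using i 3 less.prems by (intro less.IH) auto
        finally show ?thesis .
      qed
      have "q / 2 * \<rho> ^ (n - N) * alive a \<beta> N = 2 * (q / 2 * \<rho> ^ (n - A - N) * alive a \<beta> N)"
      proof -
        have "\<rho> ^ (n - N) = \<rho> ^ A * \<rho> ^ (n - A - N)" using 3 by (simp flip: power_add)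
        then show ?thesis using \<rho> by simp
      qed
      also have "\<dots> \<le> c * real A * (q / 2 * \<rho> ^ (n - A - N) * alive a \<beta> N)"
        using A q z0 \<rho> by (intro mult_right_mono) auto
      also have "\<dots> = (\<Sum>i\<in>{n - A..<n}. c * (q / 2 * \<rho> ^ (n - A - N) * alive a \<beta> N))"
        using 3 by simp
      also have "\<dots> \<le> (\<Sum>i\<in>{n - A..<n}. \<beta> (Suc i))"
      proof (intro sum_mono)
        fix i assume i: "i \<in> {n - A..<n}"
        have "c * (q / 2 * \<rho> ^ (n - A - N) * alive a \<beta> N) \<le> c * alive a \<beta> i"
          using IH[OF i] c by (intro mult_left_mono) auto
        also have "\<dots> \<le> \<beta> (Suc i)" using i 3 less.prems by auto
        finally show "c * (q / 2 * \<rho> ^ (n - A - N) * alive a \<beta> N) \<le> \<beta> (Suc i)" .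
      qed
      also have "\<dots> = (\<Sum>i\<in>Suc ` {n - A..<n}. \<beta> i)" by (subst sum.reindex) (auto simp: o_def)
      also have "\<dots> \<le> alive a \<beta> n"
        unfolding alive_def using nn n0[of n] that 3 by (intro sum_mono2) auto
      finally show ?thesis .
    qed
  qed
  have crude: "q ^ (n - N) * alive a \<beta> N \<le> alive a \<beta> n"
    if nn: "\<And>i. 0 \<le> \<beta> i" and "N \<le> n"
      and births: "\<And>i. N \<le> i \<Longrightarrow> i < n \<Longrightarrow> c * alive a \<beta> i \<le> \<beta> (Suc i)" for \<beta> N n
    using \<open>N \<le> n\<close> births
  proof (induction n rule: dec_induct)
    case (step k)
    have "q ^ (Suc k - N) * alive a \<beta> N = q * (q ^ (k - N) * alive a \<beta> N)"
      using step by (simp add: Suc_diff_le)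
    also have "\<dots> \<le> c * alive a \<beta> k" 
      using step q alive_nonneg[of \<beta> N, OF nn] by (intro mult_mono) auto
    also have "\<dots> \<le> \<beta> (Suc k)" using step by auto
    also have "\<dots> \<le> alive a \<beta> (Suc k)" by (intro birth_le_alive nn) auto
    finally show ?case .
  qed simp
  show ?thesis
  proof (rule that[OF \<rho>(1) \<kappa>])
    fix \<beta> :: "nat \<Rightarrow> real" and N n
    assume nn: "\<And>i. 0 \<le> \<beta> i" and "N \<le> n"
      and births: "\<And>i. N \<le> i \<Longrightarrow> i < n \<Longrightarrow> c * alive a \<beta> i \<le> \<beta> (Suc i)"
    note z0 = alive_nonneg[of \<beta> N, OF nn]
    define N' where "N' = max N (min n n0)"
    have N': "N \<le> N'" "N' \<le> n" "N' - N \<le> n0" using \<open>N \<le> n\<close> by (auto simp: N'_def)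
    have "q ^ n0 \<le> q ^ (N' - N)" using N' q by (intro power_decreasing) auto
    then have 1: "q ^ n0 * alive a \<beta> N \<le> alive a \<beta> N'"
      using crude[of \<beta> N N', OF nn N'(1)] births N' mult_right_mono[OF _ z0] by (smt (verit) order_less_le_trans)
    have 2: "q / 2 * \<rho> ^ (n - N') * alive a \<beta> N' \<le> alive a \<beta> n"
    proof (cases "n0 \<le> N'")
      case True
      then show ?thesis using N' births by (intro main nn) auto
    next
      case False
      then have "n = N'" using N' by (auto simp: N'_def)
      moreover have "q / 2 * alive a \<beta> N' \<le> 1 * alive a \<beta> N'"
        using q alive_nonneg[of \<beta> N', OF nn] by (intro mult_right_mono) auto
      ultimately show ?thesis by simp
    qed
    have "\<rho> ^ (n - N) \<le> \<rho> ^ (n0 + (n - N'))" using \<rho> N' by (intro power_increasing) auto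
    then have "\<rho> ^ (n - N) / \<rho> ^ n0 \<le> \<rho> ^ (n - N')" using \<rho> by (simp add: power_add field_simps)
    then have "q / 2 * (\<rho> ^ (n - N) / \<rho> ^ n0) * (q ^ n0 * alive a \<beta> N)
       \<le> q / 2 * \<rho> ^ (n - N') * alive a \<beta> N'"
      using 1 q \<rho> z0 by (intro mult_mono mult_left_mono) auto
    moreover have "\<kappa> * \<rho> ^ (n - N) * alive a \<beta> N
        = q / 2 * (\<rho> ^ (n - N) / \<rho> ^ n0) * (q ^ n0 * alive a \<beta> N)"
      by (simp add: \<kappa>_def)
    ultimately show "\<kappa> * \<rho> ^ (n - N) * alive a \<beta> N \<le> alive a \<beta> n"
      using 2 by linarith
  qed
qed

text \<open>
  The mean satisfies the hypothesis of \<open>growth\<close> with equality.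
\<close>

lemma mean_size_growth:
  obtains \<rho> \<kappa> :: real where "\<rho> > 1" "\<kappa> > 0" "\<And>i n. i \<le> n \<Longrightarrow> \<kappa> * \<rho> ^ (n - i) * mean_size i \<le> mean_size n"
proof (rule growth[OF m_pos])
  fix \<rho> \<kappa> :: real
  assume *: "\<rho> > 1" "\<kappa> > 0" and g: "\<And>\<beta> N n. (\<And>i. 0 \<le> \<beta> i) \<Longrightarrow> N \<le> n
      \<Longrightarrow> (\<And>i. N \<le> i \<Longrightarrow> i < n \<Longrightarrow> m * alive a \<beta> i \<le> \<beta> (Suc i))
      \<Longrightarrow> \<kappa> * \<rho> ^ (n - N) * alive a \<beta> N \<le> alive a \<beta> n"
  have "\<kappa> * \<rho> ^ (n - i) * mean_size i \<le> mean_size n" if "i \<le> n" for i n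
    unfolding mean_size_def using that mean_births_pos by (intro g) (auto simp: mean_births_Suc mean_size_def less_imp_le)
  with * that show thesis by blast
qed

lemma summable_inverse_e: "summable (\<lambda>n. 1 / mean_size n)"
proof (rule mean_size_growth)
  fix \<rho> \<kappa> :: real
  assume g: "\<rho> > 1" "\<kappa> > 0" "\<And>i n. i \<le> n \<Longrightarrow> \<kappa> * \<rho> ^ (n - i) * mean_size i \<le> mean_size n"
  show ?thesis
  proof (rule summable_comparison_test'[where N = 0])
    show "summable (\<lambda>n. 1 / (\<kappa> * mean_size 0) * (1 / \<rho>) ^ n)"
      using g by (intro summable_mult summable_geometric) auto
    show "norm (1 / mean_size n) \<le> 1 / (\<kappa> * mean_size 0) * (1 / \<rho>) ^ n" for n
    proof -
      have "1 / mean_size n \<le> 1 / (\<kappa> * \<rho> ^ n * mean_size 0)"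
        using g(3)[of 0 n] g mean_size_pos[of 0] mean_size_pos[of n] by (intro divide_left_mono) auto
      then show ?thesis using mean_size_pos[of n] by (simp add: power_one_over field_simps)
    qed
  qed
qed

section \<open>Convergence relative to the mean\<close>

text \<open>
  The mean number of deaths from old age between generations \<open>n\<close> and \<open>n + 1\<close>, relative to the
  mean size of the latter.
\<close>

definition loss :: "nat \<Rightarrow> real" where
  "loss n = (if a (Suc n) = a n \<and> a n \<le> n then mean_births (n - a n) / mean_size (Suc n) else 0)"

lemma loss_nonneg: "0 \<le> loss n"
  using mean_births_pos mean_size_pos by (auto simp: loss_def less_imp_le)

lemma mean_size_Suc: "mean_size (Suc n) * (1 + loss n) = (1 + m) * mean_size n"
  using alive_Suc[of mean_births n] mean_size_pos[of "Suc n"]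
  by (auto simp: loss_def mean_births_Suc field_simps simp flip: mean_size_def)

lemma mean_size_Suc_ge: "m * mean_size n \<le> mean_size (Suc n)"
  using birth_le_alive[of mean_births "Suc n" "Suc n"] mean_births_pos by (simp add: mean_births_Suc less_imp_le flip: mean_size_def)

text \<open>
  Those who die were born \<open>a n\<close> generations ago, and the mean has grown exponentially since.
\<close>

lemma loss_bound:
  obtains \<rho> C :: real where "\<rho> > 1" "C > 0" "\<And>n. loss n \<le> C / \<rho> ^ a n"
proof (rule mean_size_growth)
  fix \<rho> \<kappa> :: real
  assume *: "\<rho> > 1" "\<kappa> > 0" and g: "\<And>i n. i \<le> n \<Longrightarrow> \<kappa> * \<rho> ^ (n - i) * mean_size i \<le> mean_size n"
  have "loss n \<le> (1 / \<kappa>) / \<rho> ^ a n" for n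
  proof (cases "a (Suc n) = a n \<and> a n \<le> n")
    case True
    have "mean_births (n - a n) \<le> mean_size (n - a n)"
      unfolding mean_size_def using mean_births_pos by (intro birth_le_alive) (auto simp: less_imp_le)
    also have "\<dots> * (\<kappa> * \<rho> ^ a n) \<le> mean_size (n - a n) * (\<kappa> * \<rho> ^ (Suc n - (n - a n)))"
      using * mean_size_pos[of "n - a n"] True by (intro mult_left_mono power_increasing) auto
    also have "\<dots> \<le> mean_size (Suc n)"
      using g[of "n - a n" "Suc n"] by (simp add: mult_ac)
    finally show ?thesis
      using * mean_size_pos[of "Suc n"] True by (simp add: loss_def field_simps)
  qed (use * in \<open>auto simp: loss_def\<close>)
  with * that[of \<rho> "1 / \<kappa>"] show thesis by simp
qed

lemma loss_tendsto: "loss \<longlonglongrightarrow> 0"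
proof (rule loss_bound)
  fix \<rho> C :: real
  assume *: "\<rho> > 1" "C > 0" "\<And>n. loss n \<le> C / \<rho> ^ a n"
  have "(\<lambda>n. inverse (\<rho> ^ a n)) \<longlonglongrightarrow> 0"
    using filterlim_compose[OF LIMSEQ_inverse_realpow_zero[OF *(1)] age_lim] .
  then have "(\<lambda>n. C * inverse (\<rho> ^ a n)) \<longlonglongrightarrow> 0"
    using tendsto_mult_right_zero by blast
  then have lim: "(\<lambda>n. C / \<rho> ^ a n) \<longlonglongrightarrow> 0" by (simp add: field_simps)
  show ?thesis
    by (rule tendsto_sandwich[OF _ _ tendsto_const lim]) (use * loss_nonneg in auto)
qed

lemma mean_size_ratio: "(\<lambda>n. mean_size (Suc n) / mean_size n) \<longlonglongrightarrow> 1 + m"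
proof -
  have "(\<lambda>n. (1 + m) / (1 + loss n)) \<longlonglongrightarrow> (1 + m) / (1 + 0)"
    by (intro tendsto_intros loss_tendsto) auto
  moreover have "(1 + m) / (1 + loss n) = mean_size (Suc n) / mean_size n" for n
    using mean_size_Suc[of n] mean_size_pos[of n] loss_nonneg[of n] by (simp add: field_simps)
  ultimately show ?thesis by simp
qed

lemma abs_alive_le:
  assumes "\<And>j. j \<le> n \<Longrightarrow> \<bar>\<beta> j / mean_births j\<bar> \<le> S"
  shows "\<bar>alive a \<beta> n\<bar> \<le> S * mean_size n"
proof -
  have "\<bar>\<beta> j\<bar> \<le> S * mean_births j" if "j \<le> n" for j
    using assms[OF that] mean_births_pos[of j] by (simp add: field_simps)
  then have "(\<Sum>j\<in>{n - a n..n}. \<bar>\<beta> j\<bar>) \<le> (\<Sum>j\<in>{n - a n..n}. S * mean_births j)"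
    by (intro sum_mono) auto
  then show ?thesis
    unfolding alive_def mean_size_def sum_distrib_left using sum_abs[of \<beta> "{n - a n..n}"] by linarith
qed

text \<open>
  The size is a sum of births over the same window as its mean, so its ratio to the mean never
  exceeds the largest earlier birth ratio. One generation therefore increases the bound by at
  most the relative error \<open>C \<theta> ^ n / m\<close>, and the product of these factors is finite. The error
  is measured by the population, which suits a realised path, and by the mean, which suits
  the response to a single newborn.
\<close>

lemma birth_ratio_bounded:
  assumes "C \<ge> 0" "0 \<le> \<theta>" "\<theta> < 1"
    and err: "\<And>n. \<bar>\<beta> (Suc n) - m * alive a \<beta> n\<bar> \<le> C * \<theta> ^ n * (\<bar>alive a \<beta> n\<bar> + mean_size n)"
  obtains S where "\<And>n. \<bar>\<beta> n / mean_births n\<bar> \<le> S"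
proof -
  define S where "S n = (1 + \<bar>\<beta> 0\<bar>) * (\<Prod>k<n. 1 + C * \<theta> ^ k / m)" for n
  have S_Suc: "S (Suc n) = S n * (1 + C * \<theta> ^ n / m)" for n
    by (simp add: S_def)
  have S_pos: "S n > 0" for n
    unfolding S_def using assms m_pos by (intro mult_pos_pos prod_pos) (auto intro!: add_pos_nonneg)
  have bound: "\<bar>\<beta> j / mean_births j\<bar> \<le> S n - 1" if "j \<le> n" for j n
    using that
  proof (induction n arbitrary: j)
    case 0
    then show ?case by (simp add: S_def)
  next
    case (Suc n)
    have le: "S n \<le> S (Suc n)"
      using S_pos[of n] assms m_pos by (simp add: S_Suc)
    show ?case
    proof (cases "j \<le> n")
      case True
      then show ?thesis using Suc.IH[of j] le by simp
    next
      case False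
      then have j: "j = Suc n" using Suc.prems by simp
      have al: "\<bar>alive a \<beta> n\<bar> \<le> (S n - 1) * mean_size n" by (intro abs_alive_le Suc.IH)
      have "\<bar>\<beta> (Suc n)\<bar> \<le> m * \<bar>alive a \<beta> n\<bar> + C * \<theta> ^ n * (\<bar>alive a \<beta> n\<bar> + mean_size n)"
      proof -
        have "\<bar>m * alive a \<beta> n\<bar> = m * \<bar>alive a \<beta> n\<bar>"
          using m_pos by (simp add: abs_mult)
        then show ?thesis using err[of n] by linarith
      qed
      also have "\<dots> \<le> m * ((S n - 1) * mean_size n) + C * \<theta> ^ n * ((S n - 1) * mean_size n + mean_size n)"
        using al m_pos assms by (intro add_mono mult_left_mono) auto
      also have "\<dots> = (S (Suc n) - 1) * mean_births (Suc n)"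
        using m_pos by (simp add: S_Suc mean_births_Suc field_simps)
      finally show ?thesis
        using j mean_births_pos[of "Suc n"] by (simp add: field_simps)
    qed
  qed
  have "S n \<le> (1 + \<bar>\<beta> 0\<bar>) * exp (C / m * (1 / (1 - \<theta>)))" for n
  proof -
    have "(\<Prod>k<n. 1 + C * \<theta> ^ k / m) \<le> (\<Prod>k<n. exp (C * \<theta> ^ k / m))"
      using assms m_pos by (intro prod_mono) (auto intro!: add_nonneg_nonneg)
    also have "\<dots> = exp (C / m * (\<Sum>k<n. \<theta> ^ k))"
      by (simp add: exp_sum sum_distrib_left)
    also have "\<dots> \<le> exp (C / m * (1 / (1 - \<theta>)))"
    proof -
      have "(\<Sum>k<n. \<theta> ^ k) \<le> 1 / (1 - \<theta>)"
        using assms sum_le_suminf[of "\<lambda>k. \<theta> ^ k" "{..<n}"] by (simp add: suminf_geometric)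
      then have "C / m * (\<Sum>k<n. \<theta> ^ k) \<le> C / m * (1 / (1 - \<theta>))"
        using assms m_pos by (intro mult_left_mono) auto
      then show ?thesis by simp
    qed
    finally have "(\<Prod>k<n. 1 + C * \<theta> ^ k / m) \<le> exp (C / m * (1 / (1 - \<theta>)))"
.
    then show ?thesis unfolding S_def by (intro mult_left_mono) auto
  qed
  then have "\<bar>\<beta> n / mean_births n\<bar> \<le> (1 + \<bar>\<beta> 0\<bar>) * exp (C / m * (1 / (1 - \<theta>)))" for n
    using bound[of n n] by (smt (verit) order_refl)
  then show ?thesis using that by blast
qed

text \<open>
  Noise and deaths are the only deviations from growth by the factor \<open>1 + m\<close>. A death removes a
  birth ratio from the average that defines the size ratio, hence the difference in the first
  summand.
\<close>

lemma ratio_increment: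
  "alive a \<beta> (Suc n) / mean_size (Suc n) - alive a \<beta> n / mean_size n =
     loss n * (alive a \<beta> n / mean_size n - \<beta> (n - a n) / mean_births (n - a n))
     + (\<beta> (Suc n) - m * alive a \<beta> n) / mean_size (Suc n)"
proof -
  define D where "D = (if a (Suc n) = a n \<and> a n \<le> n then 1 else 0 :: real)"
  define i where "i = n - a n"
  have 1: "alive a \<beta> (Suc n) = alive a \<beta> n + \<beta> (Suc n) - D * \<beta> i"
    by (simp add: alive_Suc D_def i_def)
  have 2: "mean_size (Suc n) = (1 + m) * mean_size n - D * mean_births i"
    using alive_Suc[of mean_births n]
    by (cases "a (Suc n) = a n \<and> a n \<le> n") (auto simp: D_def i_def mean_births_Suc algebra_simps simp flip: mean_size_def)
  have 3: "loss n = D * mean_births i / mean_size (Suc n)" by (simp add: loss_def D_def i_def)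
  have "alive a \<beta> n / mean_size n = (1 + m) * alive a \<beta> n / mean_size (Suc n) - D * mean_births i * (alive a \<beta> n / mean_size n) / mean_size (Suc n)"
  proof -
    have "(1 + m) * alive a \<beta> n - D * mean_births i * (alive a \<beta> n / mean_size n) = alive a \<beta> n / mean_size n * mean_size (Suc n)"
      using mean_size_pos[of n] by (simp add: 2 field_simps)
    then show ?thesis using mean_size_pos[of "Suc n"] by (simp add: field_simps)
  qed
  moreover have "alive a \<beta> (Suc n) / mean_size (Suc n)
      = (alive a \<beta> n + \<beta> (Suc n)) / mean_size (Suc n) - D * mean_births i * (\<beta> i / mean_births i) / mean_size (Suc n)"
    using mean_births_pos[of i] by (simp add: 1 diff_divide_distrib)
  ultimately show ?thesis
    unfolding 3 i_def[symmetric] using mean_births_pos[of i] mean_size_pos[of n] mean_size_pos[of "Suc n"]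
    by (simp add: divide_simps) (simp add: algebra_simps)
qed

text \<open>
  By \<open>ratio_increment\<close>, the increment at time \<open>n\<close> is the noise plus a loss of order \<open>\<rho>\<close> to the
  power \<open>- a n\<close> times a sum of the previous \<open>a n + 1\<close> increments. If these are at most \<open>K \<tau> ^ k\<close>
  with \<open>\<tau> \<rho> > 1\<close>, the new contribution is small compared with \<open>K \<tau> ^ n\<close> once \<open>a n\<close> is large, and
  the bound reproduces itself. Exponential decay is essential: mere summability of the losses
  fails when \<open>a\<close> grows slowly.
\<close>

lemma ratio_converges:
  assumes "C \<ge> 0" "0 \<le> \<theta>" "\<theta> < 1"
    and err: "\<And>n. \<bar>\<beta> (Suc n) - m * alive a \<beta> n\<bar> \<le> C * \<theta> ^ n * (\<bar>alive a \<beta> n\<bar> + mean_size n)"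
  shows "convergent (\<lambda>n. alive a \<beta> n / mean_size n)"
proof -
  obtain S where S: "\<And>n. \<bar>\<beta> n / mean_births n\<bar> \<le> S"
    using birth_ratio_bounded[OF assms] by blast
  have S0: "S \<ge> 0" using S[of 0] by linarith
  define x where "x n = alive a \<beta> n / mean_size n" for n
  define u where "u n = \<bar>x (Suc n) - x n\<bar>" for n
  define \<zeta> where "\<zeta> n = \<beta> (Suc n) - m * alive a \<beta> n" for n
  have x: "\<bar>x n\<bar> \<le> S" for n
    using abs_alive_le[of n \<beta> S] S mean_size_pos[of n] by (simp add: x_def field_simps)
  obtain \<rho> c where \<rho>: "\<rho> > 1" "c > 0" and loss: "\<And>n. loss n \<le> c / \<rho> ^ a n"
    using loss_bound by blast
  (* The rate has to dominate the noise and still leave the loss small after division by tau^(a n):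
     loss n / tau^(a n) is at most of order 1 / sqrt rho ^ a n. *)
  define \<tau> where "\<tau> = max \<theta> (1 / sqrt \<rho>)"
  have sq: "sqrt \<rho> > 1" "sqrt \<rho> * sqrt \<rho> = \<rho>" using \<rho> by auto
  have \<tau>: "0 < \<tau>" "\<tau> < 1" "\<theta> \<le> \<tau>" "1 / sqrt \<rho> \<le> \<tau>"
    using assms sq by (auto simp: \<tau>_def less_max_iff_disj field_simps)
  have \<rho>\<tau>: "\<rho> * \<tau> \<ge> sqrt \<rho>"
  proof -
    have "sqrt \<rho> = \<rho> * (1 / sqrt \<rho>)" using sq by (simp add: field_simps)
    also have "\<dots> \<le> \<rho> * \<tau>" using \<tau> \<rho> by (intro mult_left_mono) auto
    finally show ?thesis .
  qed
  define C1 where "C1 = C * (S + 1)"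
  have C1: "C1 \<ge> 0" using assms S0 by (simp add: C1_def)
  define C2 where "C2 = C1 / m"
  have \<zeta>: "\<bar>\<zeta> n\<bar> \<le> C1 * \<tau> ^ n * mean_size n" for n
  proof -
    have "\<bar>\<zeta> n\<bar> \<le> C * \<theta> ^ n * (\<bar>alive a \<beta> n\<bar> + mean_size n)" using err by (simp add: \<zeta>_def)
    also have "\<dots> \<le> C * \<tau> ^ n * (S * mean_size n + mean_size n)"
      using abs_alive_le[of n \<beta> S] S assms \<tau> mean_size_pos[of n]
      by (intro mult_mono add_mono power_mono) auto
    finally show ?thesis by (simp add: C1_def algebra_simps)
  qed
  (* q n bounds the loss at time n against the increments of the last a n + 1 steps. *)
  define q where "q n = c / \<tau> * inverse (sqrt \<rho> ^ a n)" for n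
  have q_nonneg: "0 \<le> q n" for n using \<rho> \<tau> by (simp add: q_def)
  have loss_q: "loss n * \<tau> ^ (n - Suc (a n)) \<le> q n * \<tau> ^ n" if "Suc (a n) \<le> n" for n
  proof -
    have "\<tau> ^ n = \<tau> ^ (n - Suc (a n)) * (\<tau> * \<tau> ^ a n)"
      using that by (simp flip: power_add power_Suc)
    moreover have "loss n \<le> q n * (\<tau> * \<tau> ^ a n)"
    proof -
      have "sqrt \<rho> ^ a n \<le> (\<rho> * \<tau>) ^ a n" using sq \<rho>\<tau> by (intro power_mono) auto
      then have "1 / \<rho> ^ a n \<le> \<tau> ^ a n / sqrt \<rho> ^ a n"
        using \<rho> by (simp add: field_simps power_mult_distrib)
      then have "c * (1 / \<rho> ^ a n) \<le> c * (\<tau> ^ a n / sqrt \<rho> ^ a n)"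
        using \<rho> by (intro mult_left_mono) auto
      then show ?thesis using loss[of n] \<tau> by (simp add: q_def field_simps)
    qed
    ultimately show ?thesis
      using \<tau> mult_right_mono[of "loss n" "q n * (\<tau> * \<tau> ^ a n)" "\<tau> ^ (n - Suc (a n))"]
      by (simp add: mult_ac)
  qed
  have "q \<longlonglongrightarrow> c / \<tau> * 0"
    unfolding q_def
    by (intro tendsto_intros filterlim_compose[OF LIMSEQ_inverse_realpow_zero age_lim] sq)
  then have "eventually (\<lambda>n. q n < (1 - \<tau>) / 2) sequentially"
    using \<tau> by (intro order_tendstoD(2)[where y = 0]) auto
  then obtain n1 where n1: "\<And>n. n \<ge> n1 \<Longrightarrow> q n \<le> (1 - \<tau>) / 2"
    by (auto simp: eventually_sequentially intro: less_imp_le)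
  define P where "P = 2 * S * c"
  have P: "0 \<le> P" using S0 \<rho> by (simp add: P_def)
  (* The finitely many times before n1 are absorbed into the constant. *)
  define K where "K = C2 + 2 * (P + C2) + (\<Sum>k<n1. u k / \<tau> ^ k)"
  have K_ge: "C2 + 2 * (P + C2) \<le> K"
    unfolding K_def u_def using \<tau> by (simp add: sum_nonneg)
  have C2: "C2 \<ge> 0" using C1 m_pos by (simp add: C2_def)
  have K_nonneg: "0 \<le> K" using K_ge C2 P by simp
  have u: "u n \<le> K * \<tau> ^ n" for n
  proof (induction n rule: less_induct)
    case (less n)
    show ?case
    proof (cases "n < n1")
      case True
      have "u n / \<tau> ^ n \<le> (\<Sum>k<n1. u k / \<tau> ^ k)"
        using True \<tau> by (intro member_le_sum) (auto simp: u_def)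
      also have "\<dots> \<le> K" unfolding K_def using C2 P by simp
      finally show ?thesis using \<tau> by (simp add: field_simps)
    next
      case False
      define i where "i = n - a n"
      have noise: "\<bar>\<zeta> n / mean_size (Suc n)\<bar> \<le> C2 * \<tau> ^ n"
      proof -
        have "\<bar>\<zeta> n\<bar> * m \<le> C1 * \<tau> ^ n * mean_size n * m" using \<zeta>[of n] m_pos by simp
        also have "\<dots> \<le> C1 * \<tau> ^ n * mean_size (Suc n)"
          using mean_size_Suc_ge[of n] C1 \<tau> mult_left_mono[of "m * mean_size n" "mean_size (Suc n)" "C1 * \<tau> ^ n"] by (simp add: mult_ac)
        finally show ?thesis using mean_size_pos[of "Suc n"] m_pos by (simp add: C2_def field_simps)
      qed
      have drift: "loss n * \<bar>x n - \<beta> i / mean_births i\<bar> \<le> (P + (K + C2) / 2) * \<tau> ^ n"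
      proof (cases "Suc (a n) \<le> n")
        case False
        show ?thesis
        proof (cases "a n = n")
          case True
          have "\<bar>x n - \<beta> i / mean_births i\<bar> \<le> 2 * S" using x[of n] S[of i] by linarith
          moreover have "loss n \<le> c * \<tau> ^ n"
          proof -
            have "1 / \<rho> \<le> \<tau>"
            proof -
              have "sqrt \<rho> * 1 \<le> sqrt \<rho> * sqrt \<rho>"
                using sq by (intro mult_left_mono) auto
              then have "1 / \<rho> \<le> 1 / sqrt \<rho>"
                using sq \<rho> by (intro frac_le) auto
              then show ?thesis using \<tau> by linarith
            qed
            then have "(1 / \<rho>) ^ n \<le> \<tau> ^ n" using \<rho> by (intro power_mono) auto
            then have "c * (1 / \<rho>) ^ n \<le> c * \<tau> ^ n" using \<rho> by (intro mult_left_mono) auto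
            then show ?thesis using loss[of n] True by (simp add: power_one_over)
          qed
          ultimately have "loss n * \<bar>x n - \<beta> i / mean_births i\<bar> \<le> c * \<tau> ^ n * (2 * S)"
            using loss_nonneg[of n] \<rho> \<tau> by (intro mult_mono) auto
          also have "\<dots> = P * \<tau> ^ n" by (simp add: P_def)
          also have "\<dots> \<le> (P + (K + C2) / 2) * \<tau> ^ n"
            using K_nonneg C2 \<tau> by (intro mult_right_mono) auto
          finally show ?thesis .
        next
          case False
          then have "loss n = 0" using \<open>\<not> Suc (a n) \<le> n\<close> by (simp add: loss_def)
          then show ?thesis using K_nonneg C2 P \<tau> by simp
        qed
      next
        case True
        define j where "j = n - Suc (a n)"
        have j: "i = Suc j" "j < n" using True by (auto simp: i_def j_def)
        have "\<beta> i / mean_births i - x j = \<zeta> j / (m * mean_size j)"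
          using m_pos mean_size_pos[of j] by (simp add: j mean_births_Suc x_def \<zeta>_def field_simps)
        moreover have "\<bar>\<zeta> j / (m * mean_size j)\<bar> \<le> C2 * \<tau> ^ j"
          using \<zeta>[of j] m_pos mean_size_pos[of j] by (simp add: C2_def field_simps)
        ultimately have 1: "\<bar>\<beta> i / mean_births i - x j\<bar> \<le> C2 * \<tau> ^ j" by simp
        have "x n - x j = (\<Sum>k\<in>{j..<n}. x (Suc k) - x k)"
          using j by (simp add: sum_Suc_diff')
        also have "\<bar>\<dots>\<bar> \<le> (\<Sum>k\<in>{j..<n}. K * \<tau> ^ k)"
          using less.IH by (intro order_trans[OF sum_abs] sum_mono) (auto simp: u_def)
        also have "\<dots> \<le> K * (\<tau> ^ j / (1 - \<tau>))"
        proof -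
          have "(\<Sum>k\<in>{j..<n}. \<tau> ^ k) = \<tau> ^ j * (\<Sum>k<n - j. \<tau> ^ k)"
          proof -
            have "(\<Sum>k\<in>{j..<n}. \<tau> ^ k) = (\<Sum>k\<in>{0 + j..<(n - j) + j}. \<tau> ^ k)" using j by simp
            also have "\<dots> = (\<Sum>k\<in>{0..<n - j}. \<tau> ^ (k + j))"
              by (rule sum.shift_bounds_nat_ivl)
            finally show ?thesis by (simp add: power_add sum_distrib_left mult.commute atLeast0LessThan)
          qed
          also have "(\<Sum>k<n - j. \<tau> ^ k) \<le> 1 / (1 - \<tau>)"
            using \<tau> sum_le_suminf[of "\<lambda>k. \<tau> ^ k" "{..<n - j}"] by (simp add: suminf_geometric)
          finally have "(\<Sum>k\<in>{j..<n}. \<tau> ^ k) \<le> \<tau> ^ j / (1 - \<tau>)"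
            using \<tau> by (simp add: mult_left_mono)
          then show ?thesis
            unfolding sum_distrib_left[symmetric] using K_nonneg by (intro mult_left_mono)
        qed
        finally have "\<bar>x n - \<beta> i / mean_births i\<bar> \<le> (K / (1 - \<tau>) + C2) * \<tau> ^ j"
          using 1 by (simp add: algebra_simps)
        then have "loss n * \<bar>x n - \<beta> i / mean_births i\<bar> \<le> (K / (1 - \<tau>) + C2) * (loss n * \<tau> ^ j)"
          using loss_nonneg[of n] by (simp add: mult_left_mono mult.left_commute)
        also have "\<dots> \<le> (K / (1 - \<tau>) + C2) * (q n * \<tau> ^ n)"
          using loss_q[OF True] K_nonneg C2 \<tau> unfolding j_def by (intro mult_left_mono) auto
        also have "\<dots> \<le> (K / (1 - \<tau>) + C2) * ((1 - \<tau>) / 2 * \<tau> ^ n)"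
          using n1[of n] False K_nonneg C2 \<tau> by (intro mult_left_mono mult_right_mono) auto
        also have "\<dots> = (K + (1 - \<tau>) * C2) / 2 * \<tau> ^ n"
          using \<tau> by (simp add: field_simps)
        also have "\<dots> \<le> (P + (K + C2) / 2) * \<tau> ^ n"
        proof (intro mult_right_mono)
          have "(1 - \<tau>) * C2 \<le> 1 * C2" using \<tau> C2 by (intro mult_right_mono) auto
          then show "(K + (1 - \<tau>) * C2) / 2 \<le> P + (K + C2) / 2"
            using P by argo
        qed (use \<tau> in auto)
        finally show ?thesis .
      qed
      have "u n \<le> loss n * \<bar>x n - \<beta> i / mean_births i\<bar> + \<bar>\<zeta> n / mean_size (Suc n)\<bar>"
        unfolding u_def x_def ratio_increment \<zeta>_def i_def using loss_nonneg[of n]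
        by (intro order_trans[OF abs_triangle_ineq]) (simp add: abs_mult)
      also have "\<dots> \<le> (P + (K + C2) / 2 + C2) * \<tau> ^ n"
        using noise drift by (simp add: algebra_simps)
      also have "\<dots> \<le> K * \<tau> ^ n"
      proof (rule mult_right_mono)
        show "P + (K + C2) / 2 + C2 \<le> K" using K_ge P C2 by argo
      qed (use \<tau> in auto)
      finally show ?thesis .
    qed
  qed
  have "summable (\<lambda>n. x (Suc n) - x n)"
    by (rule summable_comparison_test'[where g = "\<lambda>n. K * \<tau> ^ n" and N = 0])
      (use u \<tau> in \<open>auto simp: u_def\<close>)
  then have "convergent (\<lambda>n. (\<Sum>k<n. x (Suc k) - x k))"
    by (simp add: summable_iff_convergent)
  then have "convergent (\<lambda>n. x n - x 0)" by (simp add: sum_lessThan_telescope)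
  then have "convergent (\<lambda>n. (x n - x 0) + x 0)" by (intro convergent_add convergent_const)
  then have "convergent (\<lambda>n. x n)" by simp
  then show ?thesis unfolding x_def .
qed

section \<open>Positivity of the limit and the age profile\<close>

text \<open>
  Birth ratios after time \<open>N\<close> are positive, and each is, up to the relative error \<open>C \<theta> ^ n / m\<close>,
  an average of earlier ones. Ratios from before \<open>N\<close> may vanish, but they carry weight at most
  \<open>E / mean_size n\<close> in the average. Both errors are summable, so a lower bound over a finite
  range of times loses at most half of its value in the sequel.
\<close>

lemma ratio_positive:
  assumes "C \<ge> 0" "0 \<le> \<theta>" "\<theta> < 1"
    and nn: "\<And>i. 0 \<le> \<beta> i" and pos: "\<And>n. alive a \<beta> n > 0"
    and err: "\<And>n. \<bar>\<beta> (Suc n) - m * alive a \<beta> n\<bar> \<le> C * \<theta> ^ n * alive a \<beta> n"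
    and lim: "(\<lambda>n. alive a \<beta> n / mean_size n) \<longlonglongrightarrow> w"
  shows "w > 0"
proof -
  have "(\<lambda>n. C * \<theta> ^ n) \<longlonglongrightarrow> C * 0"
    using assms by (intro tendsto_intros LIMSEQ_realpow_zero)
  then have "eventually (\<lambda>n. C * \<theta> ^ n < m / 2) sequentially"
    using m_pos by (intro order_tendstoD(2)[where y = 0]) auto
  then obtain N where N: "\<And>n. n \<ge> N \<Longrightarrow> C * \<theta> ^ n \<le> m / 2"
    by (auto simp: eventually_sequentially intro: less_imp_le)
  define E where "E = (\<Sum>i\<le>N. mean_births i)"
  have E: "E \<ge> 0" unfolding E_def using mean_births_pos by (intro sum_nonneg) (auto intro: less_imp_le)
  define p where "p n = C * \<theta> ^ n / m + E / mean_size n" for n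
  have p_nonneg: "0 \<le> p n" for n
    unfolding p_def using assms m_pos E mean_size_pos[of n] by simp
  have "summable (\<lambda>n. E * (1 / mean_size n))"
    by (intro summable_mult summable_inverse_e)
  then have "summable (\<lambda>n. E / mean_size n)" by simp
  then have sp: "summable p"
    unfolding p_def using assms by (intro summable_add summable_divide summable_mult summable_geometric) auto
  have "eventually (\<lambda>k. (\<Sum>n. p (n + k)) < 1 / 2) sequentially"
    using suminf_exist_split2[OF sp] by (intro order_tendstoD(2)[where y = 0]) auto
  then obtain N2' where "\<And>k. k \<ge> N2' \<Longrightarrow> (\<Sum>n. p (n + k)) < 1 / 2"
    by (auto simp: eventually_sequentially)
  then have N2: "max N N2' \<ge> N" "(\<Sum>n. p (n + max N N2')) < 1 / 2"
    by auto
  define N2 where "N2 = max N N2'"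
  note N2 = N2[folded N2_def]
  have tail: "(\<Sum>k\<in>{N2..<n}. p k) \<le> 1 / 2" for n
  proof -
    have "(\<Sum>k\<in>{N2..<n}. p k) = (\<Sum>k<n - N2. p (k + N2))"
    proof (cases "N2 \<le> n")
      case True
      then have "(\<Sum>k\<in>{N2..<n}. p k) = (\<Sum>k\<in>{0 + N2..<(n - N2) + N2}. p k)" by simp
      also have "\<dots> = (\<Sum>k\<in>{0..<n - N2}. p (k + N2))" by (rule sum.shift_bounds_nat_ivl)
      finally show ?thesis by (simp add: atLeast0LessThan)
    qed simp
    also have "\<dots> \<le> (\<Sum>k. p (k + N2))"
      using sp p_nonneg by (intro sum_le_suminf) (auto simp: summable_iff_shift)
    finally show ?thesis using N2 by simp
  qed
  define r where "r n = \<beta> n / mean_births n" for n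
  have r_step: "(1 - C * \<theta> ^ n / m) * (alive a \<beta> n / mean_size n) \<le> r (Suc n)" for n
  proof -
    have "(m - C * \<theta> ^ n) * alive a \<beta> n \<le> \<beta> (Suc n)"
      using err[of n] by (simp add: abs_le_iff algebra_simps)
    then have "(m - C * \<theta> ^ n) * alive a \<beta> n / (m * mean_size n) \<le> r (Suc n)"
      unfolding r_def mean_births_Suc using m_pos mean_size_pos[of n] by (intro divide_right_mono) auto
    then show ?thesis using m_pos by (simp add: field_simps)
  qed
  have half: "C * \<theta> ^ n / m \<le> 1 / 2" if "n \<ge> N" for n
    using N[OF that] m_pos by (simp add: field_simps)
  have r_pos: "r n > 0" if "n > N" for n
  proof -
    obtain k where k: "n = Suc k" "k \<ge> N" using \<open>n > N\<close> by (cases n) auto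
    have "0 < (1 - C * \<theta> ^ k / m) * (alive a \<beta> k / mean_size k)"
    proof (intro mult_pos_pos)
      show "0 < 1 - C * \<theta> ^ k / m" using half[OF k(2)] by linarith
    qed (use pos[of k] mean_size_pos[of k] in auto)
    then show ?thesis using r_step[of k] k by simp
  qed
  define \<mu> where "\<mu> = Min (r ` {N<..Suc N2})"
  have ne: "r ` {N<..Suc N2} \<noteq> {}" using N2 by auto
  have \<mu>: "\<mu> > 0" unfolding \<mu>_def using ne r_pos by (subst Min_gr_iff) auto
  have alive_ge: "(1 - E / mean_size n) * \<nu> \<le> alive a \<beta> n / mean_size n"
    if "\<nu> \<ge> 0" and r: "\<And>j. N < j \<Longrightarrow> j \<le> n \<Longrightarrow> \<nu> \<le> r j" for n \<nu>
  proof -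
    have "mean_size n = (\<Sum>j\<in>{n - a n..n} \<inter> {..N}. mean_births j) + (\<Sum>j\<in>{n - a n..n} - {..N}. mean_births j)"
      unfolding mean_size_def alive_def by (rule sum.Int_Diff) auto
    also have "(\<Sum>j\<in>{n - a n..n} \<inter> {..N}. mean_births j) \<le> E"
      unfolding E_def using mean_births_pos by (intro sum_mono2) (auto intro: less_imp_le)
    finally have "\<nu> * (mean_size n - E) \<le> \<nu> * (\<Sum>j\<in>{n - a n..n} - {..N}. mean_births j)"
      using \<open>\<nu> \<ge> 0\<close> by (intro mult_left_mono) auto
    also have "\<dots> \<le> (\<Sum>j\<in>{n - a n..n} - {..N}. \<beta> j)"
      unfolding sum_distrib_left
    proof (intro sum_mono)
      fix j assume "j \<in> {n - a n..n} - {..N}"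
      then show "\<nu> * mean_births j \<le> \<beta> j" using r[of j] mean_births_pos[of j] by (simp add: r_def field_simps)
    qed
    also have "\<dots> \<le> alive a \<beta> n"
      unfolding alive_def using nn by (intro sum_mono2) auto
    finally have "\<nu> * (mean_size n - E) / mean_size n \<le> alive a \<beta> n / mean_size n"
      using mean_size_pos[of n] by (intro divide_right_mono) auto
    moreover have "\<nu> * (mean_size n - E) / mean_size n = (1 - E / mean_size n) * \<nu>"
      using mean_size_pos[of n] by (simp add: field_simps)
    ultimately show ?thesis by simp
  qed
  have r_ge: "\<mu> * (1 - (\<Sum>k\<in>{N2..<n}. p k)) \<le> r n" if "n > N" for n
    using that
  proof (induction n rule: less_induct)
    case (less n)
    show ?case
    proof (cases "n \<le> Suc N2")
      case True
      have "\<mu> * (1 - (\<Sum>k\<in>{N2..<n}. p k)) \<le> \<mu> * 1"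
        using \<mu> p_nonneg by (intro mult_left_mono) (auto intro: sum_nonneg)
      also have "\<dots> \<le> r n" unfolding \<mu>_def using True less.prems by simp
      finally show ?thesis .
    next
      case False
      then obtain k where k: "n = Suc k" "k > N2" by (cases n) auto
      define t where "t = (\<Sum>k\<in>{N2..<k}. p k)"
      define s1 where "s1 = C * \<theta> ^ k / m"
      define s2 where "s2 = E / mean_size k"
      have t: "0 \<le> t" "t \<le> 1 / 2" using tail p_nonneg by (auto simp: t_def intro: sum_nonneg)
      have s1: "0 \<le> s1" "s1 \<le> 1 / 2" using half[of k] k N2 assms m_pos by (auto simp: s1_def)
      have s2: "0 \<le> s2" "s2 \<le> 1 / 2"
      proof -
        show "0 \<le> s2" using E mean_size_pos[of k] by (simp add: s2_def)
        have "p k \<le> (\<Sum>k\<in>{N2..<n}. p k)" using k p_nonneg by (intro member_le_sum) auto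
        moreover have "p k = s1 + s2" by (simp add: p_def s1_def s2_def)
        ultimately show "s2 \<le> 1 / 2" using tail[of n] s1 by linarith
      qed
      have al: "(1 - s2) * (\<mu> * (1 - t)) \<le> alive a \<beta> k / mean_size k"
        unfolding s2_def
      proof (rule alive_ge)
        show "0 \<le> \<mu> * (1 - t)" using \<mu> t by simp
        fix j assume j: "N < j" "j \<le> k"
        have "(\<Sum>k\<in>{N2..<j}. p k) \<le> t"
          unfolding t_def using j p_nonneg by (intro sum_mono2) auto
        then have "\<mu> * (1 - t) \<le> \<mu> * (1 - (\<Sum>k\<in>{N2..<j}. p k))"
          using \<mu> by (intro mult_left_mono) auto
        also have "\<dots> \<le> r j" using j k by (intro less.IH) auto
        finally show "\<mu> * (1 - t) \<le> r j" .
      qed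
      have "\<mu> * (1 - (\<Sum>k\<in>{N2..<n}. p k)) = \<mu> * (1 - (t + (s1 + s2)))"
        using k by (simp add: t_def s1_def s2_def p_def)
      also have "\<dots> \<le> \<mu> * ((1 - s1) * ((1 - s2) * (1 - t)))"
      proof (intro mult_left_mono)
        have "1 - (s2 + t) \<le> (1 - s2) * (1 - t)" using s2 t by (simp add: algebra_simps)
        then have "(1 - s1) * (1 - (s2 + t)) \<le> (1 - s1) * ((1 - s2) * (1 - t))"
          using s1 by (intro mult_left_mono) auto
        moreover have "1 - (t + (s1 + s2)) \<le> (1 - s1) * (1 - (s2 + t))"
          using mult_nonneg_nonneg[of s1 "s2 + t"] s1 s2 t by (simp add: algebra_simps)
        ultimately show "1 - (t + (s1 + s2)) \<le> (1 - s1) * ((1 - s2) * (1 - t))" by linarith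
      qed (use \<mu> in auto)
      also have "\<dots> = (1 - s1) * ((1 - s2) * (\<mu> * (1 - t)))" by simp
      also have "\<dots> \<le> (1 - s1) * (alive a \<beta> k / mean_size k)"
        using al s1 by (intro mult_left_mono) auto
      also have "\<dots> \<le> r n" using r_step[of k] k by (simp add: s1_def)
      finally show ?thesis .
    qed
  qed
  have "\<mu> / 4 \<le> alive a \<beta> n / mean_size n" if "n \<ge> N2" for n
  proof -
    have r2: "\<mu> / 2 \<le> r j" if "N < j" for j
    proof -
      have "\<mu> * (1 / 2) \<le> \<mu> * (1 - (\<Sum>k\<in>{N2..<j}. p k))"
        using tail[of j] \<mu> by (intro mult_left_mono) auto
      then show ?thesis using r_ge[OF that] by simp
    qed
    have "p n \<le> (\<Sum>k\<in>{N2..<Suc n}. p k)" using that p_nonneg by (intro member_le_sum) auto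
    moreover have "0 \<le> C * \<theta> ^ n / m" using assms m_pos by simp
    moreover have "p n = C * \<theta> ^ n / m + E / mean_size n" by (simp add: p_def)
    ultimately have "E / mean_size n \<le> 1 / 2" using tail[of "Suc n"] by linarith
    then have "1 / 2 * (\<mu> / 2) \<le> (1 - E / mean_size n) * (\<mu> / 2)"
      using \<mu> by (intro mult_right_mono) auto
    also have "\<dots> \<le> alive a \<beta> n / mean_size n" 
    proof (rule alive_ge)
      show "0 \<le> \<mu> / 2" using \<mu> by simp
    qed (rule r2)
    finally show ?thesis by simp
  qed
  then have "\<mu> / 4 \<le> w" by (intro LIMSEQ_le_const[OF lim]) blast
  then show ?thesis using \<mu> by simp
qed

text \<open>
  A convergent ratio with positive limit means that the population inherits the growth factor \<open>1
  + m\<close> of its mean. The individuals of age \<open>k\<close> are a proportion \<open>m\<close> of the population \<open>k + 1\<close>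
  generations ago.
\<close>

lemma age_fraction_tendsto:
  assumes "C \<ge> 0" "0 \<le> \<theta>" "\<theta> < 1" and pos: "\<And>n. alive a \<beta> n > 0"
    and err: "\<And>n. \<bar>\<beta> (Suc n) - m * alive a \<beta> n\<bar> \<le> C * \<theta> ^ n * alive a \<beta> n"
    and lim: "(\<lambda>n. alive a \<beta> n / mean_size n) \<longlonglongrightarrow> w" and "w > 0"
  shows "(\<lambda>n. \<beta> (n - k) / alive a \<beta> n) \<longlonglongrightarrow> m / (m + 1) ^ (k + 1)"
proof -
  define z where "z n = alive a \<beta> n" for n
  have zp: "z n > 0" for n using pos by (simp add: z_def)
  have [simp]: "z n \<noteq> 0" for n using zp[of n] by simp
  have step: "(\<lambda>n. z n / z (Suc n)) \<longlonglongrightarrow> 1 / (m + 1)"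
  proof -
    have lim': "(\<lambda>n. z n / mean_size n) \<longlonglongrightarrow> w" using lim by (simp add: z_def)
    have "(\<lambda>n. (z n / mean_size n) / (z (Suc n) / mean_size (Suc n)) / (mean_size (Suc n) / mean_size n)) \<longlonglongrightarrow> w / w / (1 + m)"
      by (intro tendsto_divide mean_size_ratio lim' LIMSEQ_Suc[OF lim']) (use \<open>w > 0\<close> m_pos in auto)
    moreover have "(z n / mean_size n) / (z (Suc n) / mean_size (Suc n)) / (mean_size (Suc n) / mean_size n) = z n / z (Suc n)" for n
      using mean_size_pos[of n] mean_size_pos[of "Suc n"] by simp
    ultimately show ?thesis using \<open>w > 0\<close> by (simp add: add.commute)
  qed
  have steps: "(\<lambda>n. z n / z (n + k)) \<longlonglongrightarrow> (1 / (m + 1)) ^ k" for k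
  proof (induction k)
    case 0
    then show ?case by simp
  next
    case (Suc k)
    have "(\<lambda>n. z n / z (n + k) * (z (n + k) / z (Suc (n + k)))) \<longlonglongrightarrow> (1 / (m + 1)) ^ k * (1 / (m + 1))"
      using LIMSEQ_ignore_initial_segment[OF step, of k] by (intro tendsto_mult Suc) simp
    then show ?case by (simp add: mult.commute)
  qed
  have births: "(\<lambda>n. \<beta> (Suc n) / z n) \<longlonglongrightarrow> m"
  proof (rule LIM_zero_cancel, rule Lim_null_comparison)
    show "\<forall>\<^sub>F n in sequentially. norm (\<beta> (Suc n) / z n - m) \<le> C * \<theta> ^ n"
    proof (intro always_eventually allI)
      fix n
      have "\<beta> (Suc n) / z n - m = (\<beta> (Suc n) - m * z n) / z n"
        by (simp add: diff_divide_distrib)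
      then have "\<bar>\<beta> (Suc n) / z n - m\<bar> = \<bar>\<beta> (Suc n) - m * z n\<bar> / z n"
        using zp[of n] by (simp only: abs_divide abs_of_pos)
      also have "\<dots> \<le> C * \<theta> ^ n"
        using err[of n] zp[of n] by (simp only: z_def pos_divide_le_eq)
      finally show "norm (\<beta> (Suc n) / z n - m) \<le> C * \<theta> ^ n" by simp
    qed
    show "(\<lambda>n. C * \<theta> ^ n) \<longlonglongrightarrow> 0"
      by (intro tendsto_mult_right_zero LIMSEQ_realpow_zero assms(2,3))
  qed
  have "(\<lambda>n. \<beta> (Suc n) / z n * (z n / z (n + Suc k))) \<longlonglongrightarrow> m * (1 / (m + 1)) ^ Suc k"
    by (intro tendsto_mult births steps)
  moreover have "\<beta> (Suc n) / z n * (z n / z (n + Suc k)) = \<beta> (n + Suc k - k) / z (n + Suc k)" for n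
    by simp
  moreover have "m * (1 / (m + 1)) ^ Suc k = m / (m + 1) ^ (k + 1)"
    unfolding power_one_over by simp
  ultimately have "(\<lambda>n. \<beta> (n + Suc k - k) / z (n + Suc k)) \<longlonglongrightarrow> m / (m + 1) ^ (k + 1)"
    by simp
  then have "(\<lambda>n. \<beta> (n - k) / z n) \<longlonglongrightarrow> m / (m + 1) ^ (k + 1)"
    using LIMSEQ_offset[where f = "\<lambda>n. \<beta> (n - k) / z n" and k = "Suc k"] by blast
  then show ?thesis by (simp only: z_def)
qed

section \<open>Noise of the order of the three-quarter power of the size\<close>

text \<open>
  For a natural number \<open>z\<close> the deviation \<open>m / 2\<close> times \<open>z\<close> to the power \<open>3/4\<close> is at most \<open>m z /
  2\<close>.
\<close>

lemma calm_births_ge: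
  fixes z :: real
  assumes "4 * (y - m * z)\<^sup>2 \<le> m\<^sup>2 * z * sqrt z" "z = 0 \<or> z \<ge> 1"
  shows "m / 2 * z \<le> y"
proof -
  have z: "0 \<le> z" using assms by auto
  have "sqrt z \<le> z"
    using assms(2) by (auto intro!: real_le_lsqrt simp: power2_eq_square)
  then have "m\<^sup>2 * z * sqrt z \<le> m\<^sup>2 * z * z" using z by (intro mult_left_mono) auto
  then have "(2 * (m * z - y))\<^sup>2 \<le> (m * z)\<^sup>2"
    using assms(1) by (simp add: power2_eq_square algebra_simps)
  then have "2 * (m * z - y) \<le> m * z"
    using power2_le_imp_le m_pos z by (smt (verit) mult_nonneg_nonneg)
  then show ?thesis by simp
qed

text \<open>
  The relative noise is at most \<open>m / 2\<close> times the size to the power \<open>- 1/4\<close>, and the size grows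
  exponentially. This brings a calm path within the scope of \<open>ratio_converges\<close> and
  \<open>ratio_positive\<close>; the noise before \<open>N\<close> is absorbed into the constant.
\<close>

lemma calm_error_decay:
  assumes nn: "\<And>i. 0 \<le> \<beta> i" and ge1: "\<And>n. 1 \<le> alive a \<beta> n"
    and calm: "\<And>n. N \<le> n \<Longrightarrow> 4 * (\<beta> (Suc n) - m * alive a \<beta> n)\<^sup>2 \<le> m\<^sup>2 * alive a \<beta> n * sqrt (alive a \<beta> n)"
  obtains C \<theta> where "C \<ge> 0" "0 \<le> \<theta>" "\<theta> < 1"
    "\<And>n. \<bar>\<beta> (Suc n) - m * alive a \<beta> n\<bar> \<le> C * \<theta> ^ n * alive a \<beta> n"
proof -
  define z where "z n = alive a \<beta> n" for n
  define \<zeta> where "\<zeta> n = \<beta> (Suc n) - m * z n" for n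
  have z1: "1 \<le> z n" for n using ge1 by (simp add: z_def)
  have "m / 2 > 0" using m_pos by simp
  from growth[OF this] obtain \<rho> \<kappa> :: real where \<rho>: "\<rho> > 1" "\<kappa> > 0"
    and g: "\<And>\<beta> N n. (\<And>i. 0 \<le> \<beta> i) \<Longrightarrow> N \<le> n \<Longrightarrow> (\<And>i. N \<le> i \<Longrightarrow> i < n \<Longrightarrow> m / 2 * alive a \<beta> i \<le> \<beta> (Suc i))
       \<Longrightarrow> \<kappa> * \<rho> ^ (n - N) * alive a \<beta> N \<le> alive a \<beta> n"
    by blast
  have grow: "\<kappa> / \<rho> ^ N * \<rho> ^ n \<le> z n" if "N \<le> n" for n
  proof -
    have "\<kappa> * \<rho> ^ (n - N) * 1 \<le> \<kappa> * \<rho> ^ (n - N) * z N"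
      using z1 \<rho> by (intro mult_left_mono) auto
    also have "\<dots> \<le> z n"
      unfolding z_def
    proof (rule g[OF nn that])
      fix i assume i: "N \<le> i" "i < n"
      show "m / 2 * alive a \<beta> i \<le> \<beta> (Suc i)"
        using calm[OF i(1)] ge1[of i] by (intro calm_births_ge) auto
    qed
    finally show ?thesis using \<rho> that by (simp add: power_diff)
  qed
  define f :: "real \<Rightarrow> real" where "f x = sqrt (sqrt x)" for x
  define \<theta> where "\<theta> = 1 / f \<rho>"
  have f\<rho>: "f \<rho> > 1" using \<rho> by (simp add: f_def)
  define C0 where "C0 = m / 2 / f (\<kappa> / \<rho> ^ N)"
  have f\<kappa>: "f (\<kappa> / \<rho> ^ N) > 0" using \<rho> by (simp add: f_def)
  have late: "\<bar>\<zeta> n\<bar> \<le> C0 * \<theta> ^ n * z n" if n: "N \<le> n" for n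
  proof -
    define x where "x = f (z n)"
    have x: "x > 0" using z1[of n] by (simp add: x_def f_def)
    have sq: "sqrt (z n) = x\<^sup>2" using z1[of n] by (simp add: x_def f_def)
    have zx: "z n = x ^ 4"
    proof -
      have "z n = (sqrt (z n))\<^sup>2" using z1[of n] by simp
      then show ?thesis unfolding sq by (simp flip: power_mult)
    qed
    have "f (\<kappa> / \<rho> ^ N) * f \<rho> ^ n \<le> x"
      using grow[OF n] \<rho> by (simp add: x_def f_def flip: real_sqrt_mult real_sqrt_power)
    then have "m / 2 / x \<le> m / 2 / (f (\<kappa> / \<rho> ^ N) * f \<rho> ^ n)"
      using f\<rho> f\<kappa> m_pos by (intro divide_left_mono mult_pos_pos) (auto simp: x)
    also have "\<dots> = C0 * \<theta> ^ n"
      by (simp add: C0_def \<theta>_def power_one_over)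
    finally have 1: "m / 2 / x * z n \<le> C0 * \<theta> ^ n * z n"
      using z1[of n] by (intro mult_right_mono) auto
    have "(2 * \<zeta> n)\<^sup>2 = 4 * (\<zeta> n)\<^sup>2" by (simp add: power_mult_distrib)
    also have "\<dots> \<le> m\<^sup>2 * z n * sqrt (z n)" using calm[OF n] by (simp only: \<zeta>_def z_def)
    also have "\<dots> = (m * x ^ 3)\<^sup>2"
      unfolding sq unfolding zx by (simp add: power_mult_distrib flip: power_mult power_add)
    finally have "\<bar>2 * \<zeta> n\<bar> \<le> \<bar>m * x ^ 3\<bar>"
      unfolding abs_le_square_iff .
    also have "\<bar>m * x ^ 3\<bar> = m * x ^ 3" using m_pos x by simp
    also have "\<dots> = 2 * (m / 2 / x * z n)"
      unfolding zx using x by (simp add: power3_eq_cube power4_eq_xxxx)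
    finally show ?thesis using 1 by linarith
  qed
  define C where "C = C0 + (\<Sum>k<N. \<bar>\<zeta> k\<bar> / (\<theta> ^ k * z k))"
  have \<theta>: "0 < \<theta>" "\<theta> < 1" using f\<rho> by (auto simp: \<theta>_def)
  have zpos: "0 < z k" for k using z1[of k] by linarith
  have C0: "C0 \<ge> 0" using f\<kappa> m_pos by (simp add: C0_def)
  have S0: "0 \<le> (\<Sum>k<N. \<bar>\<zeta> k\<bar> / (\<theta> ^ k * z k))"
    using zpos \<theta> by (intro sum_nonneg divide_nonneg_nonneg mult_nonneg_nonneg) (auto simp: less_imp_le)
  have "\<bar>\<zeta> n\<bar> \<le> C * \<theta> ^ n * z n" for n
  proof (cases "N \<le> n")
    case True
    have "C0 * (\<theta> ^ n * z n) \<le> C * (\<theta> ^ n * z n)"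
      using S0 \<theta> zpos[of n] by (intro mult_right_mono) (auto simp: C_def)
    then show ?thesis using late[OF True] unfolding mult.assoc by (rule order_trans[rotated])
  next
    case False
    have "\<bar>\<zeta> n\<bar> / (\<theta> ^ n * z n) \<le> (\<Sum>k<N. \<bar>\<zeta> k\<bar> / (\<theta> ^ k * z k))"
      using False \<theta> zpos by (intro member_le_sum) (auto simp: less_imp_le)
    then have "\<bar>\<zeta> n\<bar> / (\<theta> ^ n * z n) \<le> C" using C0 by (simp add: C_def)
    moreover have "\<theta> ^ n * z n > 0" using \<theta> zpos[of n] by simp
    ultimately show ?thesis by (simp only: pos_divide_le_eq mult.assoc)
  qed
  then have err: "\<And>n. \<bar>\<beta> (Suc n) - m * alive a \<beta> n\<bar> \<le> C * \<theta> ^ n * alive a \<beta> n"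
    unfolding z_def \<zeta>_def .
  have "C \<ge> 0" using C0 S0 unfolding C_def by (rule add_nonneg_nonneg)
  from that[OF this less_imp_le[OF \<theta>(1)] \<theta>(2) err] show ?thesis .
qed

section \<open>Shares of the mean population\<close>

text \<open>
  The contribution of one newborn of generation \<open>i\<close> to the mean of generation \<open>n\<close>, as a fraction
  of that mean.
\<close>

definition share :: "nat \<Rightarrow> nat \<Rightarrow> real" where
  "share i n = alive a (response a m i) n / mean_size n"

lemma share_0 [simp]: "share 0 n = 1"
  using mean_size_pos[of n] by (simp add: share_def mean_size_def mean_births_def)

lemma share_nonneg: "0 \<le> share i n"
  using mean_size_pos[of n] by (simp add: share_def alive_nonneg response_nonneg)

lemma share_le: "share i n \<le> 1 / mean_births i"
  using alive_response_le[of i n] mean_size_pos[of n] mean_births_pos[of i] by (simp add: share_def field_simps)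

text \<open>
  The response solves the recursion up to an error in the single generation \<open>i - 1\<close>, which any
  exponential bound with a suitable constant covers.
\<close>

lemma share_convergent: "convergent (share i)"
proof -
  define C where "C = 2 ^ (i - 1) / mean_size (i - 1)"
  have C: "C \<ge> 0" using mean_size_pos[of "i - 1"] by (simp add: C_def)
  have "convergent (\<lambda>n. alive a (response a m i) n / mean_size n)"
  proof (rule ratio_converges[OF C, of "1 / 2"])
    fix n
    have al: "0 \<le> alive a (response a m i) n" by (intro alive_nonneg response_nonneg)
    show "\<bar>response a m i (Suc n) - m * alive a (response a m i) n\<bar>
      \<le> C * (1 / 2) ^ n * (\<bar>alive a (response a m i) n\<bar> + mean_size n)"
    proof (cases "i = Suc n")
      case True
      have "1 = C * (1 / 2) ^ n * mean_size n"
        using True mean_size_pos[of n] by (simp add: C_def power_one_over)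
      also have "\<dots> \<le> C * (1 / 2) ^ n * (\<bar>alive a (response a m i) n\<bar> + mean_size n)"
        using C by (intro mult_left_mono) auto
      finally show ?thesis using True by (simp add: response_Suc)
    next
      case False
      then show ?thesis using C mean_size_pos[of n] by (simp add: response_Suc)
    qed
  qed auto
  then show ?thesis by (simp add: share_def[abs_def])
qed

definition share_lim :: "nat \<Rightarrow> real" where "share_lim i = lim (share i)"

lemma share_tendsto: "share i \<longlonglongrightarrow> share_lim i"
  unfolding share_lim_def using share_convergent convergent_LIMSEQ_iff by blast

lemma share_diff_sq_le:
  "mean_size i * (share (Suc i) n - share_lim (Suc i))\<^sup>2 \<le> 1 / m\<^sup>2 * (1 / mean_size i)"
proof -
  have "0 \<le> share_lim (Suc i)" "share_lim (Suc i) \<le> 1 / mean_births (Suc i)"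
    using share_nonneg share_le
    by (auto intro!: LIMSEQ_le_const[OF share_tendsto] LIMSEQ_le_const2[OF share_tendsto])
  then have "\<bar>share (Suc i) n - share_lim (Suc i)\<bar> \<le> 1 / mean_births (Suc i)"
    using share_nonneg[of "Suc i" n] share_le[of "Suc i" n] by linarith
  then have "\<bar>share (Suc i) n - share_lim (Suc i)\<bar>\<^sup>2 \<le> (1 / mean_births (Suc i))\<^sup>2"
    by (intro power_mono) auto
  then have "mean_size i * (share (Suc i) n - share_lim (Suc i))\<^sup>2 \<le> mean_size i * (1 / mean_births (Suc i))\<^sup>2"
    using mean_size_pos[of i] by (intro mult_left_mono) auto
  also have "\<dots> = 1 / m\<^sup>2 * (1 / mean_size i)"
    using mean_size_pos[of i] m_pos by (simp add: mean_births_Suc power2_eq_square)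
  finally show ?thesis .
qed

text \<open>
  Up to the factor \<open>\<sigma>\<^sup>2\<close> this is the squared distance in quadratic mean between the ratio of
  size to mean at time \<open>n\<close> and its limit: the noise of generation \<open>i + 1\<close> has variance \<open>\<sigma>\<^sup>2\<close>
  times \<open>mean_size i\<close> and enters with weight \<open>share (Suc i) n\<close>.
\<close>

definition spread :: "nat \<Rightarrow> real" where
  "spread n = (\<Sum>i. mean_size i * (share (Suc i) n - share_lim (Suc i))\<^sup>2)"

lemma spread_summable: "summable (\<lambda>i. mean_size i * (share (Suc i) n - share_lim (Suc i))\<^sup>2)"
  by (rule summable_comparison_test'[where N = 0, OF summable_mult[OF summable_inverse_e, of "1 / m\<^sup>2"]])
    (use share_diff_sq_le mean_size_pos in \<open>auto simp: less_imp_le\<close>)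

text \<open>
  Tannery's theorem: each share converges, and the terms are dominated by a multiple of \<open>1 /
  mean_size i\<close>.
\<close>

lemma spread_tendsto: "spread \<longlonglongrightarrow> 0"
proof -
  let ?t = "\<lambda>i n. mean_size i * (share (Suc i) n - share_lim (Suc i))\<^sup>2"
  have lim: "?t i \<longlonglongrightarrow> 0" for i
  proof -
    have "?t i \<longlonglongrightarrow> mean_size i * (share_lim (Suc i) - share_lim (Suc i))\<^sup>2"
      by (intro tendsto_intros share_tendsto)
    then show ?thesis by simp
  qed
  have bound: "\<forall>\<^sub>F (i, n) in at_top \<times>\<^sub>F sequentially. norm (?t i n) \<le> 1 / m\<^sup>2 * (1 / mean_size i)"
    using share_diff_sq_le mean_size_pos by (intro always_eventually) (auto simp: abs_mult less_imp_le)
  have "(\<lambda>n. \<Sum>i. ?t i n) \<longlonglongrightarrow> (\<Sum>i. 0)"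
    using tannerys_theorem[where a = ?t, OF lim bound summable_mult[OF summable_inverse_e]] by simp
  then show ?thesis by (simp add: spread_def[abs_def])
qed

lemma share_diff_sum_le:
  "(\<Sum>i<L. mean_size i * (share (Suc i) n - share (Suc i) k)\<^sup>2) \<le> 2 * spread n + 2 * spread k"
proof -
  have "(\<Sum>i<L. mean_size i * (share (Suc i) n - share (Suc i) k)\<^sup>2)
    \<le> (\<Sum>i<L. 2 * (mean_size i * (share (Suc i) n - share_lim (Suc i))\<^sup>2)
            + 2 * (mean_size i * (share (Suc i) k - share_lim (Suc i))\<^sup>2))"
  proof (rule sum_mono)
    fix i
    have *: "(x - y)\<^sup>2 \<le> 2 * (x - z)\<^sup>2 + 2 * (y - z)\<^sup>2" for x y z :: real
      using zero_le_power2[of "x + y - 2 * z"] by (simp add: power2_eq_square algebra_simps)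
    show "mean_size i * (share (Suc i) n - share (Suc i) k)\<^sup>2
      \<le> 2 * (mean_size i * (share (Suc i) n - share_lim (Suc i))\<^sup>2)
            + 2 * (mean_size i * (share (Suc i) k - share_lim (Suc i))\<^sup>2)"
      using mult_left_mono[OF *[of "share (Suc i) n" "share (Suc i) k" "share_lim (Suc i)"], of "mean_size i"] mean_size_pos[of i]
      by (simp add: algebra_simps)
  qed
  also have "\<dots> = 2 * (\<Sum>i<L. mean_size i * (share (Suc i) n - share_lim (Suc i))\<^sup>2)
      + 2 * (\<Sum>i<L. mean_size i * (share (Suc i) k - share_lim (Suc i))\<^sup>2)"
    by (simp add: sum.distrib sum_distrib_left)
  also have "\<dots> \<le> 2 * spread n + 2 * spread k"
    unfolding spread_def using mean_size_pos
    by (intro add_mono mult_left_mono sum_le_suminf spread_summable) (auto simp: less_imp_le)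
  finally show ?thesis .
qed

end

section \<open>The process and its noise\<close>

lemma measurable_nat_sum:
  fixes f :: "'i \<Rightarrow> 'b \<Rightarrow> nat"
  assumes "finite J" "\<And>j. j \<in> J \<Longrightarrow> f j \<in> measurable N (count_space UNIV)"
  shows "(\<lambda>\<omega>. \<Sum>j\<in>J. f j \<omega>) \<in> measurable N (count_space UNIV)"
  using assms
proof (induction J rule: finite_induct)
  case (insert i J)
  have "(\<lambda>\<omega>. f i \<omega> + (\<Sum>j\<in>J. f j \<omega>)) \<in> measurable N (count_space UNIV)"
  proof (rule measurable_compose_countable[where g = "f i"])
    show "(\<lambda>\<omega>. x + (\<Sum>j\<in>J. f j \<omega>)) \<in> measurable N (count_space UNIV)" for x
      using insert by (intro measurable_compose[OF insert.IH]) auto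
  qed (use insert in auto)
  then show ?case using insert by simp
qed simp

lemma integrable_product_of_squares:
  fixes U V :: "'b \<Rightarrow> real"
  assumes [measurable]: "U \<in> borel_measurable M" "V \<in> borel_measurable M"
    and "integrable M (\<lambda>\<omega>. (U \<omega>)\<^sup>2)" "integrable M (\<lambda>\<omega>. (V \<omega>)\<^sup>2)"
  shows "integrable M (\<lambda>\<omega>. U \<omega> * V \<omega>)"
proof (rule Bochner_Integration.integrable_bound)
  show "integrable M (\<lambda>\<omega>. (U \<omega>)\<^sup>2 + (V \<omega>)\<^sup>2)" using assms by simp
  have "\<bar>x * y\<bar> \<le> \<bar>x\<^sup>2 + y\<^sup>2\<bar>" for x y :: real
  proof -
    have "0 \<le> (\<bar>x\<bar> - \<bar>y\<bar>)\<^sup>2" by simp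
    then have "2 * (\<bar>x\<bar> * \<bar>y\<bar>) \<le> x\<^sup>2 + y\<^sup>2" by (simp add: power2_diff)
    moreover have "0 \<le> \<bar>x\<bar> * \<bar>y\<bar>" by simp
    ultimately show ?thesis unfolding abs_mult by linarith
  qed
  then show "AE \<omega> in M. norm (U \<omega> * V \<omega>) \<le> norm ((U \<omega>)\<^sup>2 + (V \<omega>)\<^sup>2)" by simp
qed simp

lemma square_sum_integrable:
  fixes U V :: "'b \<Rightarrow> real"
  assumes [measurable]: "U \<in> borel_measurable M" "V \<in> borel_measurable M"
    and "integrable M (\<lambda>\<omega>. (U \<omega>)\<^sup>2)" "integrable M (\<lambda>\<omega>. (V \<omega>)\<^sup>2)"
  shows "integrable M (\<lambda>\<omega>. (U \<omega> + V \<omega>)\<^sup>2)"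
  using assms integrable_product_of_squares[OF assms]
  by (simp add: power2_sum mult.assoc)

text \<open>
  The side condition \<open>k \<le> a n\<close> of the last generation implies all earlier ones, since \<open>a\<close> loses
  at most one per generation when followed backwards. The founder counts as the birth of
  generation \<open>0\<close>.
\<close>

lemma aging_age_conv_births:
  assumes step: "\<And>n. a n \<le> a (Suc n) \<and> a (Suc n) \<le> a n + 1"
  shows "aging_age a r n k = (if k \<le> a n \<and> k \<le> n then aging_age a r (n - k) 0 else 0)"
proof (induction n arbitrary: k)
  case (Suc n)
  show ?case
  proof (cases k)
    case (Suc j)
    then show ?thesis using Suc.IH[of j] step[of n] by auto
  qed simp
qed simp

lemma aging_total_conv_births:
  assumes step: "\<And>n. a n \<le> a (Suc n) \<and> a (Suc n) \<le> a n + 1"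
  shows "aging_total a r n = (\<Sum>i\<in>{n - a n..n}. aging_age a r i 0)"
proof -
  have "aging_total a r n = (\<Sum>k\<in>{0..a n}. if k \<le> a n \<and> k \<le> n then aging_age a r (n - k) 0 else 0)"
    unfolding aging_total_def by (intro sum.cong refl aging_age_conv_births step)
  also have "\<dots> = (\<Sum>k\<in>{0..min (a n) n}. aging_age a r (n - k) 0)"
    by (intro sum.mono_neutral_cong_right) auto
  also have "\<dots> = (\<Sum>i\<in>{n - a n..n}. aging_age a r i 0)"
    by (rule sum.reindex_bij_witness[of _ "\<lambda>i. n - i" "\<lambda>k. n - k"]) auto
  finally show ?thesis .
qed

text \<open>
  Only three features of the reproduction law enter: its mean, its variance \<open>s2\<close>, and the
  probability \<open>p\<close> of having children at all, which is positive because the mean is.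
\<close>

locale aging_process = prob_space M + maximal_ages a m
  for M :: "'w measure" and a :: "nat \<Rightarrow> nat" and m :: real +
  fixes X :: "nat \<Rightarrow> nat \<Rightarrow> 'w \<Rightarrow> nat" and s2 p :: real
  assumes X_indep: "indep_vars (\<lambda>_. count_space UNIV) (\<lambda>(j, n). X j n) ({1..} \<times> {1..})"
    and X_mean: "\<And>j n. j \<ge> 1 \<Longrightarrow> n \<ge> 1 \<Longrightarrow>
      integrable M (\<lambda>\<omega>. real (X j n \<omega>)) \<and> expectation (\<lambda>\<omega>. real (X j n \<omega>)) = m"
    and X_var: "\<And>j n. j \<ge> 1 \<Longrightarrow> n \<ge> 1 \<Longrightarrow>
      integrable M (\<lambda>\<omega>. (real (X j n \<omega>) - m)\<^sup>2) \<and> expectation (\<lambda>\<omega>. (real (X j n \<omega>) - m)\<^sup>2) = s2"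
    and X_pos: "\<And>j n. j \<ge> 1 \<Longrightarrow> n \<ge> 1 \<Longrightarrow> prob {\<omega> \<in> space M. X j n \<omega> \<ge> 1} = p"
    and p_pos: "p > 0"
begin

definition Z :: "nat \<Rightarrow> 'w \<Rightarrow> nat" where "Z n \<omega> = aging_Z a X n \<omega>"
definition births :: "'w \<Rightarrow> nat \<Rightarrow> real" where "births \<omega> n = real (aging_Z_age a X n 0 \<omega>)"

text \<open>
  The value \<open>1\<close> at time \<open>0\<close> treats the founder as a source, so that superposition produces the
  whole process, its mean included.
\<close>

definition noise :: "nat \<Rightarrow> 'w \<Rightarrow> real" where
  "noise n \<omega> = (case n of 0 \<Rightarrow> 1 | Suc k \<Rightarrow> births \<omega> (Suc k) - m * Z k \<omega>)"

lemma Z_alive: "real (Z n \<omega>) = alive a (births \<omega>) n"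
  by (simp add: Z_def births_def aging_Z_def aging_Z_age_def alive_def aging_total_conv_births[of a, OF age_step])

lemma births_0 [simp]: "births \<omega> 0 = 1" by (simp add: births_def aging_Z_age_def)
lemma births_nonneg: "0 \<le> births \<omega> n" by (simp add: births_def)
lemma Z_0 [simp]: "Z 0 \<omega> = 1" by (simp add: Z_def aging_Z_def aging_total_def sum.atLeast0_atMost_Suc)
lemma noise_0 [simp]: "noise 0 \<omega> = 1" by (simp add: noise_def)
lemma noise_Suc: "noise (Suc n) \<omega> = births \<omega> (Suc n) - m * Z n \<omega>" by (simp add: noise_def)

lemma births_Suc: "births \<omega> (Suc n) = (\<Sum>j = 1..Z n \<omega>. real (X j (Suc n) \<omega>))"
  unfolding births_def aging_Z_age_def Z_def aging_Z_def aging_age_newborn by simp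

lemma noise_Suc_sum: "noise (Suc n) \<omega> = (\<Sum>j = 1..Z n \<omega>. real (X j (Suc n) \<omega>) - m)"
  by (simp add: noise_Suc births_Suc sum_subtractf mult.commute)

lemma Z_absorbing:
  assumes "Z n \<omega> = 0" "n \<le> k"
  shows "Z k \<omega> = 0"
  using assms(2)
proof (induction k rule: dec_induct)
  case base
  show ?case by fact
next
  case (step k)
  then have "alive a (births \<omega>) k = 0" using Z_alive[of k \<omega>] by simp
  moreover have "births \<omega> (Suc k) = 0" using step by (simp add: births_Suc)
  ultimately have "alive a (births \<omega>) (Suc k) \<le> 0"
    using births_nonneg[of \<omega> "k - a k"] by (simp add: alive_Suc)
  then show ?case using Z_alive[of "Suc k" \<omega>] by simp
qed

lemma Z_superposition:
  assumes "n \<le> L"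
  shows "real (Z n \<omega>) = (\<Sum>i\<le>L. noise i \<omega> * alive a (response a m i) n)"
  unfolding Z_alive
  by (rule alive_superposition[OF _ _ assms]) (simp_all add: noise_Suc Z_alive)

lemma Z_ratio_superposition:
  assumes "n \<le> L"
  shows "real (Z n \<omega>) / mean_size n = 1 + (\<Sum>i<L. noise (Suc i) \<omega> * share (Suc i) n)"
proof -
  have "real (Z n \<omega>) / mean_size n = (\<Sum>i\<le>L. noise i \<omega> * share i n)"
    by (simp add: Z_superposition[OF assms] sum_divide_distrib share_def)
  also have "{..L} = {..<Suc L}" by auto
  finally show ?thesis by (simp add: sum.lessThan_Suc_shift del: sum.lessThan_Suc)
qed

section \<open>Past and next generation\<close>

text \<open>
  The \<open>\<sigma>\<close>-algebra generated by the offspring numbers of the generations in \<open>T\<close>.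
\<close>

definition info :: "nat set \<Rightarrow> 'w measure" where
  "info T = sigma (space M)
     (\<Union>(j, n)\<in>{1..} \<times> T. {X j n -` A \<inter> space M | A. A \<in> sets (count_space UNIV)})"

abbreviation "past n \<equiv> info {1..n}"
abbreviation "fresh n \<equiv> info {n}"

lemma space_info [simp]: "space (info T) = space M"
  by (simp add: info_def space_measure_of_conv)

lemma sets_info: "sets (info T) = sigma_sets (space M)
     (\<Union>(j, n)\<in>{1..} \<times> T. {X j n -` A \<inter> space M | A. A \<in> sets (count_space UNIV)})"
  unfolding info_def by (rule sets_measure_of) auto

lemma X_rv:
  assumes "j \<ge> 1" "n \<ge> 1"
  shows "X j n \<in> measurable M (count_space UNIV)"
proof -
  have "\<forall>i\<in>{1..} \<times> {1..}. (case i of (j, n) \<Rightarrow> X j n) \<in> measurable M (count_space UNIV)"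
    using X_indep unfolding indep_vars_def by (rule conjunct1)
  from bspec[OF this, of "(j, n)"] assms show ?thesis by simp
qed

lemma X_info: "j \<ge> 1 \<Longrightarrow> n \<in> T \<Longrightarrow> X j n \<in> measurable (info T) (count_space UNIV)"
proof (rule measurableI)
  fix A :: "nat set"
  assume "j \<ge> 1" "n \<in> T" "A \<in> sets (count_space UNIV)"
  then show "X j n -` A \<inter> space (info T) \<in> sets (info T)"
    unfolding sets_info by (intro sigma_sets.Basic) auto
qed auto

lemma info_mono: "S \<subseteq> T \<Longrightarrow> sets (info S) \<subseteq> sets (info T)"
  unfolding sets_info by (intro sigma_sets_mono') auto

lemma subalgebra_info: "T \<subseteq> {1..} \<Longrightarrow> subalgebra M (info T)"
  unfolding subalgebra_def space_info sets_info
  by (intro conjI refl sets.sigma_sets_subset) (auto intro!: measurable_sets[OF X_rv])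

lemma measurable_info_mono:
  "f \<in> measurable (info S) N \<Longrightarrow> S \<subseteq> T \<Longrightarrow> f \<in> measurable (info T) N"
  using info_mono[of S T] unfolding measurable_def by auto

lemma info_measurable:
  "f \<in> measurable (info T) N \<Longrightarrow> T \<subseteq> {1..} \<Longrightarrow> f \<in> measurable M N"
  using measurable_from_subalg[OF subalgebra_info] by blast

lemma info_sets: "A \<in> sets (info T) \<Longrightarrow> T \<subseteq> {1..} \<Longrightarrow> A \<in> events"
  using subalgebra_info unfolding subalgebra_def by blast

text \<open>
  Grouping independent variables by disjoint sets of indices gives independent \<open>\<sigma>\<close>-algebras.
\<close>

lemma indep_info:
  assumes U: "U \<in> measurable (past n) S" and V: "V \<in> measurable (fresh (Suc n)) T"
  shows "indep_var S U T V"
proof -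
  define E where "E = (\<lambda>(j, n). {X j n -` A \<inter> space M | A. A \<in> sets (count_space UNIV)})"
  define I :: "bool \<Rightarrow> (nat \<times> nat) set" where "I = (\<lambda>x. {1..} \<times> (if x then {1..n} else {Suc n}))"
  have E_alt: "E = (\<lambda>i. {(case i of (j, n) \<Rightarrow> X j n) -` A \<inter> space M | A. A \<in> sets (count_space UNIV)})"
    by (rule ext) (simp add: E_def split: prod.split)
  then have "indep_sets E ({1..} \<times> {1..})"
    using X_indep unfolding indep_vars_def2 by simp
  then have "indep_sets E (\<Union>x\<in>UNIV. I x)"
    by (rule indep_sets_mono_index[rotated]) (auto simp: I_def split: if_splits)
  then have "indep_sets (\<lambda>x. sigma_sets (space M) (\<Union>i\<in>I x. E i)) UNIV"
  proof (rule indep_sets_collect_sigma)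
    show "Int_stable (E i)" for i
    proof (rule Int_stableI)
      fix A B assume "A \<in> E i" "B \<in> E i"
      then obtain A' B' where "A = (case i of (j, n) \<Rightarrow> X j n) -` A' \<inter> space M"
        "B = (case i of (j, n) \<Rightarrow> X j n) -` B' \<inter> space M"
        unfolding E_alt by blast
      then have "A \<inter> B = (case i of (j, n) \<Rightarrow> X j n) -` (A' \<inter> B') \<inter> space M" by blast
      then show "A \<inter> B \<in> E i" unfolding E_alt by (intro CollectI exI[of _ "A' \<inter> B'"]) simp
    qed
    show "disjoint_family_on I UNIV" by (auto simp: disjoint_family_on_def I_def split: if_splits)
  qed
  also have "(\<lambda>x. sigma_sets (space M) (\<Union>i\<in>I x. E i)) = case_bool (sets (past n)) (sets (fresh (Suc n)))"
    unfolding sets_info I_def E_def by (rule ext) (simp split: bool.split)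
  finally have ind: "indep_set (sets (past n)) (sets (fresh (Suc n)))"
    unfolding indep_set_def .
  have "{U -` A \<inter> space M | A. A \<in> sets S} \<subseteq> sets (past n)"
    using measurable_sets[OF U] by auto
  from sets.sigma_sets_subset[OF this]
  have 1: "sigma_sets (space M) {U -` A \<inter> space M | A. A \<in> sets S} \<subseteq> sets (past n)"
    unfolding space_info .
  have "{V -` A \<inter> space M | A. A \<in> sets T} \<subseteq> sets (fresh (Suc n))"
    using measurable_sets[OF V] by auto
  from sets.sigma_sets_subset[OF this]
  have 2: "sigma_sets (space M) {V -` A \<inter> space M | A. A \<in> sets T} \<subseteq> sets (fresh (Suc n))"
    unfolding space_info .
  have "indep_set (sigma_sets (space M) {U -` A \<inter> space M | A. A \<in> sets S})
      (sigma_sets (space M) {V -` A \<inter> space M | A. A \<in> sets T})"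
    unfolding indep_set_def
  proof (rule indep_sets_mono_sets[OF ind[unfolded indep_set_def]])
    fix x :: bool
    show "case_bool (sigma_sets (space M) {U -` A \<inter> space M | A. A \<in> sets S})
        (sigma_sets (space M) {V -` A \<inter> space M | A. A \<in> sets T}) x
      \<subseteq> case_bool (sets (past n)) (sets (fresh (Suc n))) x"
      using 1 2 by (cases x) simp_all
  qed
  moreover have "U \<in> measurable M S" by (rule info_measurable[OF U]) auto
  moreover have "V \<in> measurable M T" by (rule info_measurable[OF V]) auto
  ultimately show ?thesis unfolding indep_var_eq by (intro conjI)
qed

lemma nn_integral_indep:
  fixes U V :: "'w \<Rightarrow> ennreal"
  assumes "U \<in> borel_measurable (past n)" "V \<in> borel_measurable (fresh (Suc n))"
  shows "(\<integral>\<^sup>+\<omega>. U \<omega> * V \<omega> \<partial>M) = (\<integral>\<^sup>+\<omega>. U \<omega> \<partial>M) * (\<integral>\<^sup>+\<omega>. V \<omega> \<partial>M)"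
proof -
  have "(\<lambda>_. borel :: ennreal measure) = case_bool borel borel"
    by (rule ext) (simp split: bool.split)
  then have "indep_vars (\<lambda>_. borel) (case_bool U V) UNIV"
    using indep_info[OF assms] unfolding indep_var_def by simp
  then have "(\<integral>\<^sup>+\<omega>. (\<Prod>x\<in>UNIV. case_bool U V x \<omega>) \<partial>M) = (\<Prod>x\<in>UNIV. \<integral>\<^sup>+\<omega>. case_bool U V x \<omega> \<partial>M)"
    by (intro indep_vars_nn_integral) auto
  then show ?thesis
    by (simp add: UNIV_bool mult.commute)
qed

lemma aging_age_past: "aging_Z_age a X n k \<in> measurable (past n) (count_space UNIV)"
  and Z_past: "Z n \<in> measurable (past n) (count_space UNIV)"
proof -
  have sum: "Z n \<in> measurable (past n) (count_space UNIV)"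
    if "\<And>k. aging_Z_age a X n k \<in> measurable (past n) (count_space UNIV)" for n
    unfolding Z_def[abs_def] aging_Z_def aging_total_def
    using that unfolding aging_Z_age_def[abs_def] by (intro measurable_nat_sum) auto
  have age: "aging_Z_age a X n k \<in> measurable (past n) (count_space UNIV)" for n k
  proof (induction n arbitrary: k)
    case 0
    then show ?case by (simp add: aging_Z_age_def[abs_def])
  next
    case (Suc n)
    have lift: "past n = info {1..n}" "{1..n} \<subseteq> {1..Suc n}" by auto
    show ?case
    proof (cases k)
      case 0
      have "(\<lambda>\<omega>. \<Sum>j = 1..Z n \<omega>. X j (Suc n) \<omega>) \<in> measurable (past (Suc n)) (count_space UNIV)"
      proof (rule measurable_compose_countable[where g = "Z n"])
        show "(\<lambda>\<omega>. \<Sum>j = 1..z. X j (Suc n) \<omega>) \<in> measurable (past (Suc n)) (count_space UNIV)" for z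
          by (intro measurable_nat_sum X_info) auto
        show "Z n \<in> measurable (past (Suc n)) (count_space UNIV)"
          using sum[OF Suc] by (rule measurable_info_mono) auto
      qed
      then show ?thesis
        unfolding 0 aging_Z_age_def[abs_def] Z_def aging_Z_def aging_age_newborn .
    next
      case (Suc j)
      have "aging_Z_age a X n j \<in> measurable (past (Suc n)) (count_space UNIV)"
        using Suc.IH by (rule measurable_info_mono) auto
      then show ?thesis using Suc by (simp add: aging_Z_age_def[abs_def])
    qed
  qed
  show "aging_Z_age a X n k \<in> measurable (past n) (count_space UNIV)" by (rule age)
  show "Z n \<in> measurable (past n) (count_space UNIV)" by (intro sum age)
qed

lemma real_Z_past: "n \<le> k \<Longrightarrow> (\<lambda>\<omega>. real (Z n \<omega>)) \<in> borel_measurable (past k)"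
  by (intro measurable_compose[OF measurable_info_mono[OF Z_past]]) auto

lemma births_past: "n \<le> k \<Longrightarrow> (\<lambda>\<omega>. births \<omega> n) \<in> borel_measurable (past k)"
  unfolding births_def by (intro measurable_compose[OF measurable_info_mono[OF aging_age_past]]) auto

lemma noise_past: "n \<le> k \<Longrightarrow> noise n \<in> borel_measurable (past k)"
proof (cases n)
  case (Suc i)
  assume "n \<le> k"
  then have "(\<lambda>\<omega>. births \<omega> (Suc i) - m * real (Z i \<omega>)) \<in> borel_measurable (past k)"
    using Suc by (intro borel_measurable_diff borel_measurable_times borel_measurable_const births_past real_Z_past) auto
  then show ?thesis unfolding Suc noise_Suc[abs_def, symmetric] .
qed (simp add: noise_0[abs_def])

lemma past_rv: "f \<in> measurable (past n) N \<Longrightarrow> f \<in> measurable M N"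
  by (rule info_measurable) auto

lemma Z_rv [measurable]: "(\<lambda>\<omega>. real (Z n \<omega>)) \<in> borel_measurable M"
  using past_rv[OF real_Z_past[OF order_refl]] .
lemma births_rv [measurable]: "(\<lambda>\<omega>. births \<omega> n) \<in> borel_measurable M"
  using past_rv[OF births_past[OF order_refl]] .
lemma noise_rv [measurable]: "noise n \<in> borel_measurable M"
  using past_rv[OF noise_past[OF order_refl]] .
lemma Z_count_rv [measurable]: "Z n \<in> measurable M (count_space UNIV)"
  using past_rv[OF Z_past] .

text \<open>
  Conditioning on the past without conditional expectations: on each of the countably many
  events that the size is \<open>z\<close>, the function \<open>f z\<close> of the next generation is independent of the
  past and may be integrated separately. Both moments of the noise come from this rule.
\<close>

lemma nn_integral_next_generation:
  fixes h :: "'w \<Rightarrow> ennreal" and f :: "nat \<Rightarrow> 'w \<Rightarrow> ennreal"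
  assumes h: "h \<in> borel_measurable (past n)"
    and f: "\<And>z. f z \<in> borel_measurable (fresh (Suc n))"
    and g: "\<And>z. (\<integral>\<^sup>+\<omega>. f z \<omega> \<partial>M) = g z"
  shows "(\<integral>\<^sup>+\<omega>. h \<omega> * f (Z n \<omega>) \<omega> \<partial>M) = (\<integral>\<^sup>+\<omega>. h \<omega> * g (Z n \<omega>) \<partial>M)"
proof -
  define A where "A z = {\<omega> \<in> space M. Z n \<omega> = z}" for z
  have dis: "disjoint_family A" by (auto simp: disjoint_family_on_def A_def)
  have A: "A z \<in> sets (past n)" for z
    using measurable_sets[OF Z_past, of "{z}" n] by (auto simp: A_def vimage_def Int_def conj_commute)
  have hA: "(\<lambda>\<omega>. h \<omega> * indicator (A z) \<omega>) \<in> borel_measurable (past n)" for z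
    using h A by measurable
  have split: "h \<omega> * k (Z n \<omega>) \<omega> = (\<Sum>z. h \<omega> * indicator (A z) \<omega> * k z \<omega>)"
    if "\<omega> \<in> space M" for \<omega> and k :: "nat \<Rightarrow> 'w \<Rightarrow> ennreal"
  proof -
    have "(\<Sum>z. (h \<omega> * k z \<omega>) * indicator (A z) \<omega>) = h \<omega> * k (Z n \<omega>) \<omega>"
      using that by (intro suminf_cmult_indicator dis) (simp add: A_def)
    then show ?thesis by (simp add: mult_ac)
  qed
  note [measurable] = past_rv[OF hA] info_measurable[OF f]
  have "(\<integral>\<^sup>+\<omega>. h \<omega> * f (Z n \<omega>) \<omega> \<partial>M) = (\<integral>\<^sup>+\<omega>. (\<Sum>z. h \<omega> * indicator (A z) \<omega> * f z \<omega>) \<partial>M)"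
    by (intro nn_integral_cong split)
  also have "\<dots> = (\<Sum>z. \<integral>\<^sup>+\<omega>. h \<omega> * indicator (A z) \<omega> * f z \<omega> \<partial>M)"
    by (intro nn_integral_suminf borel_measurable_times_ennreal past_rv[OF hA] info_measurable[OF f]) auto
  also have "\<dots> = (\<Sum>z. \<integral>\<^sup>+\<omega>. h \<omega> * indicator (A z) \<omega> * g z \<partial>M)"
  proof (intro suminf_cong)
    fix z
    have "(\<integral>\<^sup>+\<omega>. h \<omega> * indicator (A z) \<omega> * f z \<omega> \<partial>M) = (\<integral>\<^sup>+\<omega>. h \<omega> * indicator (A z) \<omega> \<partial>M) * g z"
      by (simp add: nn_integral_indep[OF hA f] g)
    also have "\<dots> = (\<integral>\<^sup>+\<omega>. h \<omega> * indicator (A z) \<omega> * g z \<partial>M)"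
      by (rule nn_integral_multc[symmetric]) (rule past_rv[OF hA])
    finally show "(\<integral>\<^sup>+\<omega>. h \<omega> * indicator (A z) \<omega> * f z \<omega> \<partial>M) = (\<integral>\<^sup>+\<omega>. h \<omega> * indicator (A z) \<omega> * g z \<partial>M)" .
  qed
  also have "\<dots> = (\<integral>\<^sup>+\<omega>. (\<Sum>z. h \<omega> * indicator (A z) \<omega> * g z) \<partial>M)"
    by (intro nn_integral_suminf[symmetric] borel_measurable_times_ennreal past_rv[OF hA]) auto
  also have "\<dots> = (\<integral>\<^sup>+\<omega>. h \<omega> * g (Z n \<omega>) \<partial>M)"
  proof (rule nn_integral_cong)
    fix \<omega> assume "\<omega> \<in> space M"
    from split[OF this, of "\<lambda>z _. g z"]
    show "(\<Sum>z. h \<omega> * indicator (A z) \<omega> * g z) = h \<omega> * g (Z n \<omega>)" by simp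
  qed
  finally show ?thesis .
qed

lemma X_real_fresh: "j \<ge> 1 \<Longrightarrow> (\<lambda>\<omega>. real (X j n \<omega>)) \<in> borel_measurable (fresh n)"
  by (intro measurable_compose[OF X_info]) auto

lemma nn_integral_births:
  assumes h: "h \<in> borel_measurable (past n)"
  shows "(\<integral>\<^sup>+\<omega>. h \<omega> * ennreal (births \<omega> (Suc n)) \<partial>M) = (\<integral>\<^sup>+\<omega>. h \<omega> * ennreal (m * real (Z n \<omega>)) \<partial>M)"
  unfolding births_Suc
proof (rule nn_integral_next_generation[OF h])
  fix z
  show "(\<lambda>\<omega>. ennreal (\<Sum>j = 1..z. real (X j (Suc n) \<omega>))) \<in> borel_measurable (fresh (Suc n))"
    by (intro measurable_compose[OF _ measurable_ennreal] borel_measurable_sum X_real_fresh) auto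
  have "(\<integral>\<^sup>+\<omega>. ennreal (\<Sum>j = 1..z. real (X j (Suc n) \<omega>)) \<partial>M)
      = ennreal (\<integral>\<omega>. (\<Sum>j = 1..z. real (X j (Suc n) \<omega>)) \<partial>M)"
    using X_mean by (intro nn_integral_eq_integral Bochner_Integration.integrable_sum) (auto intro!: sum_nonneg)
  also have "(\<integral>\<omega>. (\<Sum>j = 1..z. real (X j (Suc n) \<omega>)) \<partial>M) = (\<Sum>j = 1..z. m)"
    using X_mean by (subst Bochner_Integration.integral_sum) (auto intro!: sum.cong)
  finally show "(\<integral>\<^sup>+\<omega>. ennreal (\<Sum>j = 1..z. real (X j (Suc n) \<omega>)) \<partial>M) = ennreal (m * real z)"
    by (simp add: mult.commute)
qed

text \<open>
  Variances of independent variables add up; the sum is built one summand at a time, with the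
  mixed term vanishing by independence.
\<close>

lemma centred_sum:
  fixes n z :: nat
  defines "S \<equiv> \<lambda>z \<omega>. \<Sum>j = 1..z. real (X j (Suc n) \<omega>) - m"
  shows "integrable M (\<lambda>\<omega>. (S z \<omega>)\<^sup>2)" and "expectation (\<lambda>\<omega>. (S z \<omega>)\<^sup>2) = s2 * real z"
proof -
  define Y where "Y j \<omega> = real (X j (Suc n) \<omega>) - m" for j \<omega>
  have Y: "integrable M (Y j)" "expectation (Y j) = 0" "integrable M (\<lambda>\<omega>. (Y j \<omega>)\<^sup>2)"
    "expectation (\<lambda>\<omega>. (Y j \<omega>)\<^sup>2) = s2" if "j \<ge> 1" for j
    using X_mean[of j "Suc n"] X_var[of j "Suc n"] that by (auto simp: Y_def[abs_def] prob_space)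
  have S: "S z \<omega> = (\<Sum>j = 1..z. Y j \<omega>)" for z \<omega> by (simp add: S_def Y_def)
  define C where "C i \<omega> = real ((case i of (j, n) \<Rightarrow> X j n) \<omega>) - m" for i \<omega>
  have ind: "indep_vars (\<lambda>_. borel) C ({1..} \<times> {1..})"
    unfolding C_def by (rule indep_vars_compose2[OF X_indep, where Y = "\<lambda>_ x. real x - m"]) auto
  have SC: "S z = (\<lambda>\<omega>. \<Sum>i\<in>{1..z} \<times> {Suc n}. C i \<omega>)" for z
    by (auto simp: fun_eq_iff S C_def Y_def intro!: sum.reindex_bij_witness[of _ fst "\<lambda>j. (j, Suc n)"])
  have "integrable M (S z) \<and> expectation (S z) = 0 \<and> integrable M (\<lambda>\<omega>. (S z \<omega>)\<^sup>2) \<and> expectation (\<lambda>\<omega>. (S z \<omega>)\<^sup>2) = s2 * real z"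
  proof (induction z)
    case 0
    then show ?case by (simp add: S[abs_def])
  next
    case (Suc z)
    have SS: "S (Suc z) \<omega> = Y (Suc z) \<omega> + S z \<omega>" for \<omega> by (simp add: S)
    have "indep_var borel (C (Suc z, Suc n)) borel (S z)"
      unfolding SC by (rule indep_vars_sum[OF _ _ indep_vars_subset[OF ind]]) auto
    then have iv: "indep_var borel (Y (Suc z)) borel (S z)"
      by (simp add: C_def[abs_def] Y_def[abs_def])
    note yy = Y[of "Suc z"]
    have pr: "integrable M (\<lambda>\<omega>. Y (Suc z) \<omega> * S z \<omega>)" "expectation (\<lambda>\<omega>. Y (Suc z) \<omega> * S z \<omega>) = 0"
      using indep_var_integrable[OF iv] indep_var_lebesgue_integral[OF iv] Suc yy by auto
    have sq: "(S (Suc z) \<omega>)\<^sup>2 = (Y (Suc z) \<omega>)\<^sup>2 + 2 * (Y (Suc z) \<omega> * S z \<omega>) + (S z \<omega>)\<^sup>2" for \<omega>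
      by (simp add: SS power2_sum)
    show ?case
      unfolding sq unfolding SS using Suc yy pr by (simp add: algebra_simps)
  qed
  then show "integrable M (\<lambda>\<omega>. (S z \<omega>)\<^sup>2)" "expectation (\<lambda>\<omega>. (S z \<omega>)\<^sup>2) = s2 * real z" by auto
qed

lemma s2_nonneg: "0 \<le> s2"
proof -
  have "0 \<le> expectation (\<lambda>\<omega>. (real (X 1 1 \<omega>) - m)\<^sup>2)" by (intro Bochner_Integration.integral_nonneg) simp
  moreover have "expectation (\<lambda>\<omega>. (real (X 1 1 \<omega>) - m)\<^sup>2) = s2"
    using X_var[OF order_refl order_refl] by (rule conjunct2)
  ultimately show ?thesis by (simp only:)
qed

lemma nn_integral_noise_sq:
  assumes h: "h \<in> borel_measurable (past n)"
  shows "(\<integral>\<^sup>+\<omega>. h \<omega> * ennreal ((noise (Suc n) \<omega>)\<^sup>2) \<partial>M) = (\<integral>\<^sup>+\<omega>. h \<omega> * ennreal (s2 * real (Z n \<omega>)) \<partial>M)"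
  unfolding noise_Suc_sum
proof (rule nn_integral_next_generation[OF h])
  fix z
  show "(\<lambda>\<omega>. ennreal ((\<Sum>j = 1..z. real (X j (Suc n) \<omega>) - m)\<^sup>2)) \<in> borel_measurable (fresh (Suc n))"
    by (intro measurable_compose[OF _ measurable_ennreal] borel_measurable_power borel_measurable_sum
        borel_measurable_diff X_real_fresh) auto
  show "(\<integral>\<^sup>+\<omega>. ennreal ((\<Sum>j = 1..z. real (X j (Suc n) \<omega>) - m)\<^sup>2) \<partial>M) = ennreal (s2 * real z)"
    using centred_sum[where n = n and z = z] by (subst nn_integral_eq_integral) auto
qed

lemma prob_first_fertile:
  assumes A: "A \<in> sets (past n)"
  shows "prob (A \<inter> {\<omega> \<in> space M. X 1 (Suc n) \<omega> \<ge> 1}) = p * prob A"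
proof -
  have "{\<omega> \<in> space M. X 1 (Suc n) \<omega> \<ge> 1} \<in> sets (fresh (Suc n))"
    using measurable_sets[OF X_info[of 1 "Suc n" "{Suc n}"], of "{1..}"]
    by (simp add: vimage_def Int_def conj_commute)
  moreover have "indep_var (past n) (\<lambda>\<omega>. \<omega>) (fresh (Suc n)) (\<lambda>\<omega>. \<omega>)"
    by (rule indep_info[where n = n]) auto
  ultimately have "prob ((\<lambda>\<omega>. (\<omega>, \<omega>)) -` (A \<times> {\<omega> \<in> space M. X 1 (Suc n) \<omega> \<ge> 1}) \<inter> space M)
    = prob ((\<lambda>\<omega>. \<omega>) -` A \<inter> space M) * prob ((\<lambda>\<omega>. \<omega>) -` {\<omega> \<in> space M. X 1 (Suc n) \<omega> \<ge> 1} \<inter> space M)"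
    using A by (intro indep_varD) auto
  moreover have "(\<lambda>\<omega>. \<omega>) -` A \<inter> space M = A" using sets.sets_into_space[OF A] by auto
  moreover have "(\<lambda>\<omega>. (\<omega>, \<omega>)) -` (A \<times> {\<omega> \<in> space M. X 1 (Suc n) \<omega> \<ge> 1}) \<inter> space M
      = A \<inter> {\<omega> \<in> space M. X 1 (Suc n) \<omega> \<ge> 1}" by auto
  moreover have "(\<lambda>\<omega>. \<omega>) -` {\<omega> \<in> space M. X 1 (Suc n) \<omega> \<ge> 1} \<inter> space M
      = {\<omega> \<in> space M. X 1 (Suc n) \<omega> \<ge> 1}" by auto
  ultimately show ?thesis
    using X_pos[of 1 "Suc n"] by (simp only: mult.commute)
qed

section \<open>Second moments\<close>

text \<open>
  The variance of the noise given the past is \<open>s2\<close> times the current size. Together with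
  \<open>Z_Suc_le\<close> this carries square integrability from one generation to the next.
\<close>

lemma noise_sq_integrable_step:
  assumes "integrable M (\<lambda>\<omega>. (real (Z n \<omega>))\<^sup>2)"
  shows "integrable M (\<lambda>\<omega>. (noise (Suc n) \<omega>)\<^sup>2)"
    and "expectation (\<lambda>\<omega>. (noise (Suc n) \<omega>)\<^sup>2) = s2 * expectation (\<lambda>\<omega>. real (Z n \<omega>))"
proof -
  have int: "integrable M (\<lambda>\<omega>. s2 * real (Z n \<omega>))"
    using integrable_product_of_squares[where M = M and U = "\<lambda>_. 1" and V = "\<lambda>\<omega>. real (Z n \<omega>)"] assms by simp
  have "(\<integral>\<^sup>+\<omega>. ennreal ((noise (Suc n) \<omega>)\<^sup>2) \<partial>M) = (\<integral>\<^sup>+\<omega>. ennreal (s2 * real (Z n \<omega>)) \<partial>M)"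
    using nn_integral_noise_sq[of "\<lambda>_. 1" n] by simp
  also have "\<dots> = ennreal (expectation (\<lambda>\<omega>. s2 * real (Z n \<omega>)))"
    by (intro nn_integral_eq_integral int) (simp add: s2_nonneg)
  finally have *: "(\<integral>\<^sup>+\<omega>. ennreal ((noise (Suc n) \<omega>)\<^sup>2) \<partial>M) = ennreal (expectation (\<lambda>\<omega>. s2 * real (Z n \<omega>)))" .
  show "integrable M (\<lambda>\<omega>. (noise (Suc n) \<omega>)\<^sup>2)"
    by (rule integrableI_nonneg) (simp_all add: *)
  have "expectation (\<lambda>\<omega>. (noise (Suc n) \<omega>)\<^sup>2) = expectation (\<lambda>\<omega>. s2 * real (Z n \<omega>))"
    by (rule integral_eq_nn_integral[THEN trans]) (simp_all add: * s2_nonneg)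
  then show "expectation (\<lambda>\<omega>. (noise (Suc n) \<omega>)\<^sup>2) = s2 * expectation (\<lambda>\<omega>. real (Z n \<omega>))" by simp
qed

lemma Z_Suc_le: "real (Z (Suc n) \<omega>) \<le> (1 + m) * real (Z n \<omega>) + noise (Suc n) \<omega>"
  using births_nonneg[of \<omega> "n - a n"] unfolding Z_alive alive_Suc noise_Suc
  by (simp add: algebra_simps)

lemma Z_sq_integrable: "integrable M (\<lambda>\<omega>. (real (Z n \<omega>))\<^sup>2)"
proof (induction n)
  case (Suc n)
  have "integrable M (\<lambda>\<omega>. ((1 + m) * real (Z n \<omega>) + noise (Suc n) \<omega>)\<^sup>2)"
    using Suc noise_sq_integrable_step(1)[OF Suc]
    by (intro square_sum_integrable) (auto simp: power_mult_distrib)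
  then show ?case
    by (rule Bochner_Integration.integrable_bound)
      (use Z_Suc_le in \<open>auto intro!: AE_I2 power_mono\<close>)
qed simp

lemmas noise_Suc_sq_integrable = noise_sq_integrable_step(1)[OF Z_sq_integrable]

lemma Z_integrable: "integrable M (\<lambda>\<omega>. real (Z n \<omega>))"
  using integrable_product_of_squares[where M = M and U = "\<lambda>_. 1" and V = "\<lambda>\<omega>. real (Z n \<omega>)"] Z_sq_integrable by simp

lemma births_Suc_sq_integrable: "integrable M (\<lambda>\<omega>. (births \<omega> (Suc n))\<^sup>2)"
proof -
  have "integrable M (\<lambda>\<omega>. (noise (Suc n) \<omega> + m * real (Z n \<omega>))\<^sup>2)"
    using Z_sq_integrable noise_Suc_sq_integrable
    by (intro square_sum_integrable) (auto simp: power_mult_distrib)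
  then show ?thesis by (simp add: noise_Suc)
qed

text \<open>
  The noise is centred given the past. For nonnegative \<open>U\<close> this is the first moment identity
  \<open>nn_integral_births\<close>; in general \<open>U\<close> is split into positive and negative part.
\<close>

lemma noise_orthogonal:
  assumes U: "U \<in> borel_measurable (past n)" and sq: "integrable M (\<lambda>\<omega>. (U \<omega>)\<^sup>2)"
  shows "integrable M (\<lambda>\<omega>. U \<omega> * noise (Suc n) \<omega>)"
    and "expectation (\<lambda>\<omega>. U \<omega> * noise (Suc n) \<omega>) = (0 :: real)"
proof -
  have prod: "integrable M (\<lambda>\<omega>. V \<omega> * noise (Suc n) \<omega>)" "integrable M (\<lambda>\<omega>. V \<omega> * births \<omega> (Suc n))"
    "integrable M (\<lambda>\<omega>. V \<omega> * (m * real (Z n \<omega>)))"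
    if "V \<in> borel_measurable (past n)" "integrable M (\<lambda>\<omega>. (V \<omega>)\<^sup>2)" for V
  proof -
    note V = past_rv[OF that(1)] that(2)
    show "integrable M (\<lambda>\<omega>. V \<omega> * noise (Suc n) \<omega>)"
      by (rule integrable_product_of_squares[OF V(1) noise_rv V(2) noise_Suc_sq_integrable])
    show "integrable M (\<lambda>\<omega>. V \<omega> * births \<omega> (Suc n))"
      by (rule integrable_product_of_squares[OF V(1) births_rv V(2) births_Suc_sq_integrable])
    have "integrable M (\<lambda>\<omega>. (m * real (Z n \<omega>))\<^sup>2)"
      using Z_sq_integrable by (simp add: power_mult_distrib)
    then show "integrable M (\<lambda>\<omega>. V \<omega> * (m * real (Z n \<omega>)))"
      by (intro integrable_product_of_squares[OF V(1) _ V(2)]) measurable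
  qed
  have nonneg: "expectation (\<lambda>\<omega>. V \<omega> * noise (Suc n) \<omega>) = 0"
    if V: "V \<in> borel_measurable (past n)" "integrable M (\<lambda>\<omega>. (V \<omega>)\<^sup>2)" and "\<And>\<omega>. 0 \<le> V \<omega>" for V
  proof -
    note [measurable] = past_rv[OF V(1)]
    have "ennreal (expectation (\<lambda>\<omega>. V \<omega> * births \<omega> (Suc n)))
        = (\<integral>\<^sup>+\<omega>. ennreal (V \<omega>) * ennreal (births \<omega> (Suc n)) \<partial>M)"
      using that births_nonneg by (subst nn_integral_eq_integral[symmetric, OF prod(2)]) (auto simp: ennreal_mult)
    also have "\<dots> = (\<integral>\<^sup>+\<omega>. ennreal (V \<omega>) * ennreal (m * real (Z n \<omega>)) \<partial>M)"
      using V by (intro nn_integral_births) auto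
    also have "\<dots> = ennreal (expectation (\<lambda>\<omega>. V \<omega> * (m * real (Z n \<omega>))))"
      using that m_pos by (subst nn_integral_eq_integral[symmetric, OF prod(3)]) (auto simp: ennreal_mult)
    finally have "expectation (\<lambda>\<omega>. V \<omega> * births \<omega> (Suc n)) = expectation (\<lambda>\<omega>. V \<omega> * (m * real (Z n \<omega>)))"
      using that births_nonneg m_pos by (subst (asm) ennreal_inj) (auto intro!: Bochner_Integration.integral_nonneg)
    then have "expectation (\<lambda>\<omega>. V \<omega> * births \<omega> (Suc n) - V \<omega> * (m * real (Z n \<omega>))) = 0"
      using prod(2,3)[OF V] by simp
    then show ?thesis by (simp add: noise_Suc right_diff_distrib)
  qed
  show "integrable M (\<lambda>\<omega>. U \<omega> * noise (Suc n) \<omega>)" by (rule prod[OF assms])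
  define P where "P \<omega> = max (U \<omega>) 0" for \<omega>
  define N where "N \<omega> = max (- U \<omega>) 0" for \<omega>
  have meas: "P \<in> borel_measurable (past n)" "N \<in> borel_measurable (past n)"
    using U unfolding P_def[abs_def] N_def[abs_def] by measurable
  note [measurable] = past_rv[OF U] past_rv[OF meas(1)] past_rv[OF meas(2)]
  have sqs: "integrable M (\<lambda>\<omega>. (P \<omega>)\<^sup>2)" "integrable M (\<lambda>\<omega>. (N \<omega>)\<^sup>2)"
    by (rule Bochner_Integration.integrable_bound[OF sq]; simp add: P_def N_def max_def)+
  have "expectation (\<lambda>\<omega>. U \<omega> * noise (Suc n) \<omega>)
     = expectation (\<lambda>\<omega>. P \<omega> * noise (Suc n) \<omega> - N \<omega> * noise (Suc n) \<omega>)"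
    by (intro Bochner_Integration.integral_cong) (auto simp: P_def N_def max_def)
  also have "\<dots> = 0"
    using nonneg[OF meas(1) sqs(1)] nonneg[OF meas(2) sqs(2)] prod(1)[OF meas(1) sqs(1)] prod(1)[OF meas(2) sqs(2)]
    by (simp add: P_def N_def)
  finally show "expectation (\<lambda>\<omega>. U \<omega> * noise (Suc n) \<omega>) = 0" .
qed

lemma noise_Suc_mean: "integrable M (noise (Suc n))" "expectation (noise (Suc n)) = 0"
  using noise_orthogonal[of "\<lambda>_. 1" n] by auto

text \<open>
  In the superposition only the founder has a nonzero mean.
\<close>

lemma expectation_Z: "expectation (\<lambda>\<omega>. real (Z n \<omega>)) = mean_size n"
proof -
  have "expectation (\<lambda>\<omega>. real (Z n \<omega>) / mean_size n) = expectation (\<lambda>\<omega>. 1 + (\<Sum>i<n. noise (Suc i) \<omega> * share (Suc i) n))"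
    by (intro Bochner_Integration.integral_cong refl Z_ratio_superposition) simp
  also have "\<dots> = 1"
    using noise_Suc_mean by (simp add: prob_space)
  finally show ?thesis using mean_size_pos[of n] by simp
qed

lemma expectation_noise_sq: "expectation (\<lambda>\<omega>. (noise (Suc n) \<omega>)\<^sup>2) = s2 * mean_size n"
  using noise_sq_integrable_step(2)[OF Z_sq_integrable] expectation_Z by simp

text \<open>
  The partial sum up to \<open>L\<close> belongs to the past of the next noise term, so the mixed terms
  vanish by \<open>noise_orthogonal\<close>.
\<close>

lemma second_moment_noise_sum:
  fixes c :: "nat \<Rightarrow> real"
  shows "integrable M (\<lambda>\<omega>. (\<Sum>i<L. noise (Suc i) \<omega> * c i)\<^sup>2)"
    and "expectation (\<lambda>\<omega>. (\<Sum>i<L. noise (Suc i) \<omega> * c i)\<^sup>2) = s2 * (\<Sum>i<L. mean_size i * (c i)\<^sup>2)"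
proof -
  define T where "T L \<omega> = (\<Sum>i<L. noise (Suc i) \<omega> * c i)" for L \<omega>
  have past: "T L \<in> borel_measurable (past L)" for L
    unfolding T_def[abs_def] by (intro borel_measurable_sum borel_measurable_times noise_past) auto
  have "integrable M (\<lambda>\<omega>. (T L \<omega>)\<^sup>2) \<and> expectation (\<lambda>\<omega>. (T L \<omega>)\<^sup>2) = s2 * (\<Sum>i<L. mean_size i * (c i)\<^sup>2)"
  proof (induction L)
    case 0
    then show ?case by (simp add: T_def)
  next
    case (Suc L)
    have sq: "(T (Suc L) \<omega>)\<^sup>2 = (T L \<omega>)\<^sup>2 + 2 * c L * (T L \<omega> * noise (Suc L) \<omega>) + (c L)\<^sup>2 * (noise (Suc L) \<omega>)\<^sup>2" for \<omega>
      by (simp add: T_def power2_sum power_mult_distrib)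
    note [simp] = noise_orthogonal[OF past conjunct1[OF Suc.IH]] noise_Suc_sq_integrable[of L]
      expectation_noise_sq[of L]
    have "expectation (\<lambda>\<omega>. (T (Suc L) \<omega>)\<^sup>2) = s2 * (\<Sum>i<L. mean_size i * (c i)\<^sup>2) + (c L)\<^sup>2 * (s2 * mean_size L)"
      unfolding sq using Suc.IH by simp
    moreover have "integrable M (\<lambda>\<omega>. (T (Suc L) \<omega>)\<^sup>2)"
      unfolding sq using Suc.IH by simp
    ultimately show ?case by (simp add: algebra_simps)
  qed
  then show "integrable M (\<lambda>\<omega>. (\<Sum>i<L. noise (Suc i) \<omega> * c i)\<^sup>2)"
    "expectation (\<lambda>\<omega>. (\<Sum>i<L. noise (Suc i) \<omega> * c i)\<^sup>2) = s2 * (\<Sum>i<L. mean_size i * (c i)\<^sup>2)"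
    by (simp_all add: T_def)
qed

lemma ratio_difference_L2:
  shows "integrable M (\<lambda>\<omega>. (real (Z n \<omega>) / mean_size n - real (Z k \<omega>) / mean_size k)\<^sup>2)"
    and "expectation (\<lambda>\<omega>. (real (Z n \<omega>) / mean_size n - real (Z k \<omega>) / mean_size k)\<^sup>2) \<le> s2 * (2 * spread n + 2 * spread k)"
proof -
  define L where "L = max n k"
  have eq: "real (Z n \<omega>) / mean_size n - real (Z k \<omega>) / mean_size k
      = (\<Sum>i<L. noise (Suc i) \<omega> * (share (Suc i) n - share (Suc i) k))" for \<omega>
    using Z_ratio_superposition[of n L \<omega>] Z_ratio_superposition[of k L \<omega>]
    by (simp add: L_def right_diff_distrib sum_subtractf)
  show "integrable M (\<lambda>\<omega>. (real (Z n \<omega>) / mean_size n - real (Z k \<omega>) / mean_size k)\<^sup>2)"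
    unfolding eq by (rule second_moment_noise_sum)
  show "expectation (\<lambda>\<omega>. (real (Z n \<omega>) / mean_size n - real (Z k \<omega>) / mean_size k)\<^sup>2) \<le> s2 * (2 * spread n + 2 * spread k)"
    unfolding eq second_moment_noise_sum(2)
    by (intro mult_left_mono share_diff_sum_le s2_nonneg)
qed

section \<open>Almost sure control of the noise\<close>

text \<open>
  The noise is at most \<open>m / 2\<close> times the size to the power \<open>3/4\<close>. The exponent lies strictly
  between \<open>1/2\<close>, the order of the typical fluctuation, which makes exceptions rare, and \<open>1\<close>,
  which makes the relative noise decay as the population grows.
\<close>

definition calm :: "nat \<Rightarrow> 'w \<Rightarrow> bool" where
  "calm n \<omega> \<longleftrightarrow> 4 * (noise (Suc n) \<omega>)\<^sup>2 \<le> m\<^sup>2 * real (Z n \<omega>) * sqrt (real (Z n \<omega>))"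

lemma calm_past: "{\<omega> \<in> space M. calm n \<omega>} \<in> sets (past (Suc n))"
proof -
  have [measurable]: "noise (Suc n) \<in> borel_measurable (past (Suc n))"
    "(\<lambda>\<omega>. real (Z n \<omega>)) \<in> borel_measurable (past (Suc n))"
    by (rule noise_past, simp) (rule real_Z_past, simp)
  have "{\<omega> \<in> space (past (Suc n)). 4 * (noise (Suc n) \<omega>)\<^sup>2 \<le> m\<^sup>2 * real (Z n \<omega>) * sqrt (real (Z n \<omega>))}
      \<in> sets (past (Suc n))"
    by measurable
  then show ?thesis by (simp add: calm_def)
qed

lemma past_mono: "n \<le> k \<Longrightarrow> A \<in> sets (past n) \<Longrightarrow> A \<in> sets (past k)"
  using info_mono[of "{1..n}" "{1..k}"] by auto

lemma past_events: "A \<in> sets (past n) \<Longrightarrow> A \<in> events"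
  by (rule info_sets) auto

lemma calm_event [measurable]: "{\<omega> \<in> space M. calm n \<omega>} \<in> events"
  using calm_past by (rule past_events)

lemma calm_run_past: "{\<omega> \<in> space M. \<forall>i\<in>{N..<n}. calm i \<omega>} \<in> sets (past n)"
proof (cases "N < n")
  case True
  have "{\<omega> \<in> space M. \<forall>i\<in>{N..<n}. calm i \<omega>} = (\<Inter>i\<in>{N..<n}. {\<omega> \<in> space M. calm i \<omega>})"
    using True by auto
  also have "\<dots> \<in> sets (past n)"
    using True by (intro sets.finite_INT past_mono[OF _ calm_past]) auto
  finally show ?thesis .
next
  case False
  then show ?thesis using sets.top[of "past n"] by simp
qed

lemma calm_births: "calm n \<omega> \<Longrightarrow> m / 2 * real (Z n \<omega>) \<le> births \<omega> (Suc n)"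
  unfolding calm_def noise_Suc by (rule calm_births_ge) auto

lemma calm_extinct: "Z n \<omega> = 0 \<Longrightarrow> calm n \<omega>"
  by (simp add: calm_def noise_Suc_sum)

text \<open>
  Chebyshev's inequality with the noise scaled by a quantity that the past determines.
\<close>

lemma prob_not_calm:
  assumes A: "A \<in> sets (past n)" and v: "v > 0" "\<And>\<omega>. \<omega> \<in> A \<Longrightarrow> v \<le> real (Z n \<omega>)"
  shows "prob (A \<inter> {\<omega> \<in> space M. \<not> calm n \<omega>}) \<le> 4 * s2 / (m\<^sup>2 * sqrt v) * prob A"
proof -
  define r where "r \<omega> = m\<^sup>2 * real (Z n \<omega>) * sqrt (real (Z n \<omega>))" for \<omega>
  define h where "h \<omega> = ennreal (indicator A \<omega> * (4 / r \<omega>))" for \<omega>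
  have [measurable]: "(\<lambda>\<omega>. real (Z n \<omega>)) \<in> borel_measurable (past n)" by (rule real_Z_past) simp
  note [measurable] = A
  have h: "h \<in> borel_measurable (past n)"
    unfolding h_def[abs_def] r_def[abs_def] by measurable
  have Zp: "real (Z n \<omega>) > 0" if "\<omega> \<in> A" for \<omega> using v(2)[OF that] v(1) by linarith
  have r: "r \<omega> > 0" if "\<omega> \<in> A" for \<omega>
    unfolding r_def using Zp[OF that] m_pos by simp
  let ?B = "A \<inter> {\<omega> \<in> space M. \<not> calm n \<omega>}"
  have AM: "A \<in> events" using A by (rule past_events)
  have B: "?B \<in> events" using AM by measurable
  have "ennreal (prob ?B) = (\<integral>\<^sup>+\<omega>. indicator ?B \<omega> \<partial>M)"
    using B by (simp add: emeasure_eq_measure)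
  also have "\<dots> \<le> (\<integral>\<^sup>+\<omega>. h \<omega> * ennreal ((noise (Suc n) \<omega>)\<^sup>2) \<partial>M)"
  proof (rule nn_integral_mono)
    fix \<omega>
    show "indicator ?B \<omega> \<le> h \<omega> * ennreal ((noise (Suc n) \<omega>)\<^sup>2)"
    proof (cases "\<omega> \<in> ?B")
      case True
      then have "r \<omega> \<le> 4 * (noise (Suc n) \<omega>)\<^sup>2" by (simp add: calm_def r_def)
      then have "1 \<le> 4 / r \<omega> * (noise (Suc n) \<omega>)\<^sup>2" using r[of \<omega>] True by (simp add: field_simps)
      then have "ennreal 1 \<le> ennreal (4 / r \<omega> * (noise (Suc n) \<omega>)\<^sup>2)" by (rule ennreal_leI)
      also have "\<dots> = h \<omega> * ennreal ((noise (Suc n) \<omega>)\<^sup>2)"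
        using True r[of \<omega>] by (subst ennreal_mult) (auto simp: h_def)
      finally show ?thesis using True by simp
    qed simp
  qed
  also have "\<dots> = (\<integral>\<^sup>+\<omega>. h \<omega> * ennreal (s2 * real (Z n \<omega>)) \<partial>M)"
    by (rule nn_integral_noise_sq[OF h])
  also have "\<dots> \<le> (\<integral>\<^sup>+\<omega>. ennreal (4 * s2 / (m\<^sup>2 * sqrt v)) * indicator A \<omega> \<partial>M)"
  proof (rule nn_integral_mono)
    fix \<omega>
    show "h \<omega> * ennreal (s2 * real (Z n \<omega>)) \<le> ennreal (4 * s2 / (m\<^sup>2 * sqrt v)) * indicator A \<omega>"
    proof (cases "\<omega> \<in> A")
      case True
      have "h \<omega> * ennreal (s2 * real (Z n \<omega>)) = ennreal (4 / r \<omega> * (s2 * real (Z n \<omega>)))"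
        using True r[of \<omega>] s2_nonneg by (subst ennreal_mult) (auto simp: h_def)
      also have "4 / r \<omega> * (s2 * real (Z n \<omega>)) = 4 * s2 / (m\<^sup>2 * sqrt (real (Z n \<omega>)))"
        using Zp[OF True] by (simp add: r_def)
      also have "ennreal \<dots> \<le> ennreal (4 * s2 / (m\<^sup>2 * sqrt v))"
        using v(2)[OF True] v(1) m_pos s2_nonneg
        by (intro ennreal_leI divide_left_mono mult_left_mono mult_pos_pos) auto
      finally show ?thesis using True by simp
    qed (simp add: h_def)
  qed
  also have "\<dots> = ennreal (4 * s2 / (m\<^sup>2 * sqrt v)) * ennreal (prob A)"
    using AM by (simp add: nn_integral_cmult_indicator emeasure_eq_measure)
  also have "\<dots> = ennreal (4 * s2 / (m\<^sup>2 * sqrt v) * prob A)"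
    using s2_nonneg v(1) by (subst ennreal_mult) auto
  finally show ?thesis
    using s2_nonneg v(1) by (subst (asm) ennreal_le_iff) auto
qed

text \<open>
  Consider the first exceptional generation. Up to it the population has grown exponentially, so
  the probability that generation \<open>N + d\<close> is the first exception is at most a constant times \<open>\<rho>\<close>
  to the power \<open>- d / 2\<close>, divided by \<open>\<surd>K\<close>. For large \<open>K\<close> the sum over \<open>d\<close> is at most one half.
  Stating the bound for all events \<open>A\<close> of the past replaces a conditional probability.
\<close>

lemma stay_calm:
  obtains K :: nat where "K \<ge> 1"
    "\<And>N A. A \<in> sets (past N) \<Longrightarrow> (\<And>\<omega>. \<omega> \<in> A \<Longrightarrow> K \<le> Z N \<omega>)
       \<Longrightarrow> prob A / 2 \<le> prob (A \<inter> {\<omega> \<in> space M. \<forall>n\<ge>N. calm n \<omega>})"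
proof -
  have "m / 2 > 0" using m_pos by simp
  from growth[OF this] obtain \<rho> \<kappa> :: real where \<rho>: "\<rho> > 1" "\<kappa> > 0"
    and g: "\<And>\<beta> N n. (\<And>i. 0 \<le> \<beta> i) \<Longrightarrow> N \<le> n \<Longrightarrow> (\<And>i. N \<le> i \<Longrightarrow> i < n \<Longrightarrow> m / 2 * alive a \<beta> i \<le> \<beta> (Suc i))
       \<Longrightarrow> \<kappa> * \<rho> ^ (n - N) * alive a \<beta> N \<le> alive a \<beta> n"
    by blast
  define q where "q = 1 / sqrt \<rho>"
  have q: "0 < q" "q < 1" using \<rho> by (auto simp: q_def)
  define c where "c = 4 * s2 / (m\<^sup>2 * sqrt \<kappa>)"
  have c: "c \<ge> 0" using s2_nonneg \<rho> by (simp add: c_def)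
  obtain K0 :: nat where K0: "(2 * c / (1 - q))\<^sup>2 \<le> K0" using real_arch_simple by blast
  define K where "K = Suc K0"
  have "2 * c / (1 - q) \<le> sqrt K"
  proof (rule real_le_rsqrt)
    show "(2 * c / (1 - q))\<^sup>2 \<le> K" using K0 by (simp add: K_def)
  qed
  then have cK: "c / sqrt K * (1 / (1 - q)) \<le> 1 / 2"
    using q by (simp add: K_def field_simps)
  show ?thesis
  proof (rule that[of K])
    show "1 \<le> K" by (simp add: K_def)
    fix N A assume A: "A \<in> sets (past N)" and big: "\<And>\<omega>. \<omega> \<in> A \<Longrightarrow> K \<le> Z N \<omega>"
    define G where "G = {\<omega> \<in> space M. \<forall>n\<ge>N. calm n \<omega>}"
    (* D d is the event that N + d is the first exception. *)
    define B where "B d = A \<inter> {\<omega> \<in> space M. \<forall>i\<in>{N..<N + d}. calm i \<omega>}" for d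
    define D where "D d = B d \<inter> {\<omega> \<in> space M. \<not> calm (N + d) \<omega>}" for d
    have AM: "A \<in> events" using A by (rule past_events)
    have G: "G \<in> events" unfolding G_def by measurable
    have B: "B d \<in> sets (past (N + d))" for d
      unfolding B_def by (intro sets.Int past_mono[OF _ A] calm_run_past) simp
    have D: "D d \<in> events" for d
      unfolding D_def using past_events[OF B] by measurable
    have Dle: "prob (D d) \<le> c / sqrt K * q ^ d * prob A" for d
    proof -
      have Bbig: "\<kappa> * \<rho> ^ d * K \<le> real (Z (N + d) \<omega>)" if "\<omega> \<in> B d" for \<omega>
      proof -
        have "\<kappa> * \<rho> ^ d * K \<le> \<kappa> * \<rho> ^ d * real (Z N \<omega>)"
          using big[of \<omega>] that \<rho> by (intro mult_left_mono) (auto simp: B_def)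
        also have "\<dots> \<le> real (Z (N + d) \<omega>)"
        proof -
          have "\<kappa> * \<rho> ^ (N + d - N) * alive a (births \<omega>) N \<le> alive a (births \<omega>) (N + d)"
          proof (rule g[OF births_nonneg])
            fix i assume "N \<le> i" "i < N + d"
            then have "calm i \<omega>" using that by (simp add: B_def)
            from calm_births[OF this] show "m / 2 * alive a (births \<omega>) i \<le> births \<omega> (Suc i)"
              unfolding Z_alive .
          qed simp
          then show ?thesis unfolding Z_alive by simp
        qed
        finally show ?thesis .
      qed
      have "prob (D d) \<le> 4 * s2 / (m\<^sup>2 * sqrt (\<kappa> * \<rho> ^ d * K)) * prob (B d)"
        unfolding D_def using \<rho> by (intro prob_not_calm[OF B _ Bbig]) (auto simp: K_def)
      also have "4 * s2 / (m\<^sup>2 * sqrt (\<kappa> * \<rho> ^ d * K)) = c / sqrt K * q ^ d"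
        by (simp add: c_def q_def real_sqrt_mult real_sqrt_power power_one_over)
      also have "c / sqrt K * q ^ d * prob (B d) \<le> c / sqrt K * q ^ d * prob A"
        using c q AM by (intro mult_left_mono finite_measure_mono) (auto simp: B_def)
      finally show ?thesis .
    qed
    have sm: "summable (\<lambda>d. c / sqrt K * prob A * q ^ d)" using q by (intro summable_mult summable_geometric) auto
    have sD: "summable (\<lambda>d. prob (D d))"
      by (rule summable_comparison_test'[OF sm, where N = 0]) (use Dle in \<open>auto simp: mult_ac\<close>)
    have "prob (A - G) \<le> prob (\<Union>d. D d)"
    proof (rule finite_measure_mono)
      show "A - G \<subseteq> (\<Union>d. D d)"
      proof
        fix \<omega> assume \<omega>: "\<omega> \<in> A - G"
        then have sp: "\<omega> \<in> space M" using sets.sets_into_space[OF AM] by auto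
        then obtain n where n: "n \<ge> N" "\<not> calm n \<omega>" using \<omega> by (auto simp: G_def)
        then have ex: "\<exists>d. \<not> calm (N + d) \<omega>" by (intro exI[of _ "n - N"]) simp
        define d where "d = (LEAST d. \<not> calm (N + d) \<omega>)"
        have d: "\<not> calm (N + d) \<omega>" unfolding d_def using ex by (rule LeastI_ex)
        have "calm i \<omega>" if "i \<in> {N..<N + d}" for i
          using not_less_Least[of "i - N" "\<lambda>d. \<not> calm (N + d) \<omega>"] that by (auto simp: d_def)
        then have "\<omega> \<in> D d" using \<omega> sp d by (simp add: D_def B_def)
        then show "\<omega> \<in> (\<Union>d. D d)" by blast
      qed
    qed (use D in auto)
    also have "\<dots> \<le> (\<Sum>d. prob (D d))"
      using D sD by (intro finite_measure_subadditive_countably) auto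
    also have "\<dots> \<le> (\<Sum>d. c / sqrt K * prob A * q ^ d)"
      using Dle by (intro suminf_le sm sD) (simp add: mult_ac)
    also have "\<dots> = c / sqrt K * (1 / (1 - q)) * prob A"
      using q by (subst suminf_mult) (auto simp: suminf_geometric)
    also have "\<dots> \<le> 1 / 2 * prob A"
      using cK by (intro mult_right_mono) auto
    finally have "prob (A - G) \<le> prob A / 2" by simp
    moreover have "prob (A - G) = prob A - prob (A \<inter> G)"
      using AM G finite_measure_Diff'[of A G] by simp
    ultimately show "prob A / 2 \<le> prob (A \<inter> {\<omega> \<in> space M. \<forall>n\<ge>N. calm n \<omega>})"
      by (simp add: G_def)
  qed
qed

lemma X_first_le_births: "Z n \<omega> > 0 \<Longrightarrow> real (X 1 (Suc n) \<omega>) \<le> births \<omega> (Suc n)"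
  unfolding births_Suc by (rule member_le_sum) auto

text \<open>
  Whoever is numbered first has at least one child in each of the next \<open>K\<close> generations with
  probability \<open>p ^ K\<close>, independently of the past. The maximal age is at least \<open>K\<close> meanwhile, so
  all of these children are alive at the end. The children keep the population alive in between,
  so that there always is an individual numbered first.
\<close>

lemma fertile_run:
  assumes A: "A \<in> sets (past n)" and alive: "\<And>\<omega>. \<omega> \<in> A \<Longrightarrow> Z n \<omega> > 0" and age: "K \<le> a n"
  obtains A' where "A' \<subseteq> A" "A' \<in> sets (past (n + K))" "prob A' = p ^ K * prob A"
    "\<And>\<omega>. \<omega> \<in> A' \<Longrightarrow> K \<le> Z (n + K) \<omega>"
proof -
  define F where "F k = A \<inter> {\<omega> \<in> space M. \<forall>i\<in>{n..<n + k}. X 1 (Suc i) \<omega> \<ge> 1}" for k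
  define H where "H i = {\<omega> \<in> space M. X 1 (Suc i) \<omega> \<ge> 1}" for i
  have H: "H i \<in> sets (past (Suc i))" for i
    using measurable_sets[OF X_info[of 1 "Suc i" "{1..Suc i}"], of "{1..}"]
    by (simp add: H_def vimage_def Int_def conj_commute)
  have Asub: "A \<subseteq> space M" using sets.sets_into_space[OF past_events[OF A]] .
  have F0: "F 0 = A" using Asub by (auto simp: F_def)
  have FS: "F (Suc k) = F k \<inter> H (n + k)" for k
    using Asub by (auto simp: F_def H_def less_Suc_eq)
  have F: "F k \<in> sets (past (n + k)) \<and> prob (F k) = p ^ k * prob A" for k
  proof (induction k)
    case 0
    then show ?case using A by (simp add: F0)
  next
    case (Suc k)
    have "F (Suc k) \<in> sets (past (n + Suc k))"
      unfolding FS using Suc H[of "n + k"] past_mono[of "n + k" "n + Suc k"] by auto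
    moreover have "prob (F (Suc k)) = p * prob (F k)"
      unfolding FS H_def using Suc by (intro prob_first_fertile) auto
    ultimately show ?case using Suc by simp
  qed
  have mono: "a n \<le> a (n + k)" for k
    by (induction k) (use age_step in \<open>auto intro: order_trans\<close>)
  have pos: "Z (n + k) \<omega> > 0" if "\<omega> \<in> F K" "k \<le> K" for \<omega> k
    using that(2)
  proof (induction k)
    case 0
    then show ?case using that alive by (simp add: F_def)
  next
    case (Suc k)
    have "1 \<le> X 1 (Suc (n + k)) \<omega>" using that Suc.prems by (auto simp: F_def)
    then have "0 < births \<omega> (Suc (n + k))"
      using X_first_le_births[of "n + k" \<omega>] Suc by simp
    also have "\<dots> \<le> alive a (births \<omega>) (Suc (n + k))"
      by (intro birth_le_alive births_nonneg) auto
    finally show ?case using Z_alive[of "Suc (n + k)" \<omega>] by simp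
  qed
  have "K \<le> Z (n + K) \<omega>" if \<omega>: "\<omega> \<in> F K" for \<omega>
  proof -
    have "real K = (\<Sum>i\<in>{n..<n + K}. 1)" by simp
    also have "\<dots> \<le> (\<Sum>i\<in>{n..<n + K}. births \<omega> (Suc i))"
    proof (rule sum_mono)
      fix i assume i: "i \<in> {n..<n + K}"
      have "1 \<le> X 1 (Suc i) \<omega>" using \<omega> i by (auto simp: F_def)
      moreover have "Z i \<omega> > 0"
      proof -
        have "i - n \<le> K" "n + (i - n) = i" using i by auto
        then show ?thesis using pos[OF \<omega>, of "i - n"] by simp
      qed
      ultimately show "1 \<le> births \<omega> (Suc i)" using X_first_le_births[of i \<omega>] by simp
    qed
    also have "\<dots> = (\<Sum>i\<in>Suc ` {n..<n + K}. births \<omega> i)"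
      by (subst sum.reindex) (auto simp: o_def)
    also have "\<dots> \<le> alive a (births \<omega>) (n + K)"
      unfolding alive_def using births_nonneg mono[of K] age by (intro sum_mono2) auto
    finally show ?thesis using Z_alive[of "n + K" \<omega>] by simp
  qed
  then show ?thesis using F[of K] by (intro that[of "F K"]) (auto simp: F_def)
qed

lemma p_le_1: "p \<le> 1"
  using X_pos[of 1 1] prob_le_1[of "{\<omega> \<in> space M. 1 \<le> X 1 1 \<omega>}"] by simp

text \<open>
  A surviving population first reaches size \<open>K\<close> by \<open>fertile_run\<close> and then stays calm by
  \<open>stay_calm\<close>; an extinct one is calm forever.
\<close>

lemma calm_from_any_history:
  obtains \<eta> :: real and n0 where "\<eta> > 0"
    "\<And>T A. n0 \<le> T \<Longrightarrow> A \<in> sets (past T) \<Longrightarrow>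
       \<eta> * prob A \<le> prob (A \<inter> {\<omega> \<in> space M. \<exists>N. \<forall>n\<ge>N. calm n \<omega>})"
proof -
  obtain K where K: "K \<ge> 1"
    "\<And>N A. A \<in> sets (past N) \<Longrightarrow> (\<And>\<omega>. \<omega> \<in> A \<Longrightarrow> K \<le> Z N \<omega>)
       \<Longrightarrow> prob A / 2 \<le> prob (A \<inter> {\<omega> \<in> space M. \<forall>n\<ge>N. calm n \<omega>})"
    using stay_calm by blast
  obtain n0 where n0: "\<And>n. n \<ge> n0 \<Longrightarrow> K \<le> a n" using eventually_age_ge by blast
  define \<eta> where "\<eta> = p ^ K / 2"
  have \<eta>: "\<eta> > 0" "\<eta> \<le> 1"
    using p_pos p_le_1 power_le_one[of p K] by (auto simp: \<eta>_def)
  define G where "G = {\<omega> \<in> space M. \<exists>N. \<forall>n\<ge>N. calm n \<omega>}"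
  have G: "G \<in> events" unfolding G_def by measurable
  have "\<eta> * prob A \<le> prob (A \<inter> G)" if T: "n0 \<le> T" and A: "A \<in> sets (past T)" for T A
  proof -
    define A0 where "A0 = A \<inter> {\<omega> \<in> space M. Z T \<omega> = 0}"
    define A1 where "A1 = A \<inter> {\<omega> \<in> space M. Z T \<omega> > 0}"
    have Zs: "{\<omega> \<in> space M. Z T \<omega> \<in> S} \<in> sets (past T)" for S
      using measurable_sets[OF Z_past, of S T] by (simp add: vimage_def Int_def conj_commute)
    have A01: "A0 \<in> sets (past T)" "A1 \<in> sets (past T)"
      using A Zs[of "{0}"] Zs[of "{0<..}"] by (auto simp: A0_def A1_def)
    note ev = past_events[OF A01(1)] past_events[OF A01(2)]
    have Asub: "A \<subseteq> space M" using sets.sets_into_space[OF past_events[OF A]] .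
    have A_split: "A = A0 \<union> A1" "A0 \<inter> A1 = {}" using Asub by (auto simp: A0_def A1_def)
    have "A0 \<subseteq> G"
      using Z_absorbing calm_extinct by (auto simp: A0_def G_def intro!: exI[of _ T])
    then have 0: "\<eta> * prob A0 \<le> prob (A0 \<inter> G)"
      using \<eta> mult_right_mono[of \<eta> 1 "prob A0"] by (simp add: Int_absorb2)
    have 1: "\<eta> * prob A1 \<le> prob (A1 \<inter> G)"
    proof (rule fertile_run[OF A01(2) _ n0[OF T]])
      fix A' assume A': "A' \<subseteq> A1" "A' \<in> sets (past (T + K))" "prob A' = p ^ K * prob A1"
        "\<And>\<omega>. \<omega> \<in> A' \<Longrightarrow> K \<le> Z (T + K) \<omega>"
      have "\<eta> * prob A1 = prob A' / 2" using A'(3) by (simp add: \<eta>_def)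
      also have "\<dots> \<le> prob (A' \<inter> {\<omega> \<in> space M. \<forall>n\<ge>T + K. calm n \<omega>})"
        by (rule K(2)[OF A'(2,4)])
      also have "\<dots> \<le> prob (A1 \<inter> G)"
        using A'(1) ev G by (intro finite_measure_mono) (auto simp: G_def)
      finally show ?thesis .
    qed (auto simp: A1_def)
    have "prob A = prob A0 + prob A1"
      unfolding A_split(1) using ev A_split(2) by (intro finite_measure_Union)
    moreover have "prob (A \<inter> G) = prob (A0 \<inter> G) + prob (A1 \<inter> G)"
      unfolding A_split(1) Int_Un_distrib2 using ev G A_split(2) by (intro finite_measure_Union) auto
    ultimately show ?thesis using 0 1 by (simp add: distrib_left)
  qed
  then show ?thesis using that[of \<eta> n0] \<eta> by (auto simp: G_def)
qed

text \<open>
  An elementary form of the zero-one law of Levy. The event \<open>G\<close> of eventual calm is approximated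
  by events \<open>Gr N T\<close> of the past of \<open>T\<close>; on the complement of such an event \<open>G\<close> still keeps a
  proportion \<open>\<eta>\<close> of the probability, but that part of \<open>G\<close> becomes negligible in the limit.
\<close>

lemma AE_eventually_calm: "AE \<omega> in M. \<exists>N. \<forall>n\<ge>N. calm n \<omega>"
proof (rule calm_from_any_history)
  fix \<eta> :: real and n0
  define G where "G = {\<omega> \<in> space M. \<exists>N. \<forall>n\<ge>N. calm n \<omega>}"
  define Gf where "Gf N = {\<omega> \<in> space M. \<forall>n\<ge>N. calm n \<omega>}" for N
  define Gr where "Gr N T = {\<omega> \<in> space M. \<forall>n\<in>{N..<T}. calm n \<omega>}" for N T
  assume \<eta>: "\<eta> > 0" and hist: "\<And>T A. n0 \<le> T \<Longrightarrow> A \<in> sets (past T) \<Longrightarrow>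
       \<eta> * prob A \<le> prob (A \<inter> {\<omega> \<in> space M. \<exists>N. \<forall>n\<ge>N. calm n \<omega>})"
  have ev: "G \<in> events" "Gf N \<in> events" "Gr N T \<in> events" for N T
    unfolding G_def Gf_def Gr_def by measurable
  have le1: "\<eta> * (1 - prob (Gr N T)) \<le> prob G - prob (Gf N)" if "n0 \<le> T" for N T
  proof -
    have "space M - Gr N T \<in> sets (past T)"
      using sets.compl_sets[OF calm_run_past[of N T]] by (simp add: Gr_def)
    then have "\<eta> * prob (space M - Gr N T) \<le> prob ((space M - Gr N T) \<inter> G)"
      unfolding G_def by (rule hist[OF that])
    also have "\<dots> \<le> prob (G - Gf N)"
      using ev by (intro finite_measure_mono) (auto simp: Gf_def Gr_def)
    also have "\<dots> = prob G - prob (Gf N)"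
      using ev by (intro finite_measure_Diff) (auto simp: Gf_def G_def)
    finally show ?thesis using ev by (simp add: prob_compl)
  qed
  have le2: "\<eta> * (1 - prob (Gf N)) \<le> prob G - prob (Gf N)" for N
  proof -
    have "(\<lambda>T. prob (Gr N T)) \<longlonglongrightarrow> prob (\<Inter>T. Gr N T)"
      using ev by (intro finite_Lim_measure_decseq) (auto simp: decseq_def Gr_def)
    also have "(\<Inter>T. Gr N T) = Gf N"
      by (auto simp: Gr_def Gf_def) (metis atLeastLessThan_iff lessI)
    finally have "(\<lambda>T. \<eta> * (1 - prob (Gr N T))) \<longlonglongrightarrow> \<eta> * (1 - prob (Gf N))"
      by (intro tendsto_intros)
    then show ?thesis using le1 by (intro LIMSEQ_le_const2) auto
  qed
  have "(\<lambda>N. prob (Gf N)) \<longlonglongrightarrow> prob (\<Union>N. Gf N)"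
    using ev by (intro finite_Lim_measure_incseq) (auto simp: incseq_def Gf_def)
  also have "(\<Union>N. Gf N) = G" by (auto simp: Gf_def G_def)
  finally have lim: "(\<lambda>N. prob (Gf N)) \<longlonglongrightarrow> prob G" .
  have "(\<lambda>N. \<eta> * (1 - prob (Gf N))) \<longlonglongrightarrow> \<eta> * (1 - prob G)"
    by (intro tendsto_intros lim)
  moreover have "(\<lambda>N. prob G - prob (Gf N)) \<longlonglongrightarrow> prob G - prob G"
    by (intro tendsto_intros lim)
  ultimately have "\<eta> * (1 - prob G) \<le> prob G - prob G"
    using le2 by (intro LIMSEQ_le) auto
  then have "1 \<le> prob G" using \<eta> by (simp add: mult_le_0_iff)
  then have "prob G = 1" using prob_le_1[of G] by simp
  then show ?thesis using ev(1) by (auto dest!: AE_prob_1 elim: eventually_mono simp: G_def)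
qed

section \<open>The limit variable\<close>

text \<open>
  The maximum with \<open>0\<close> only fixes the value on the null set where the limit does not exist.
\<close>

definition W :: "'w \<Rightarrow> real" where
  "W \<omega> = max 0 (lim (\<lambda>n. real (Z n \<omega>) / mean_size n))"

lemma W_rv [measurable]: "W \<in> borel_measurable M"
proof -
  have "(\<lambda>\<omega>. real (Z n \<omega>) / mean_size n) \<in> borel_measurable M" for n by measurable
  from borel_measurable_lim_metric[OF this] show ?thesis
    unfolding W_def[abs_def] by simp
qed

lemma W_nonneg: "0 \<le> W \<omega>" by (simp add: W_def)

lemma W_eq_limit:
  assumes "(\<lambda>n. real (Z n \<omega>) / mean_size n) \<longlonglongrightarrow> w"
  shows "W \<omega> = w"
proof -
  have "0 \<le> w" using mean_size_pos by (intro LIMSEQ_le_const[OF assms]) (auto simp: less_imp_le)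
  then show ?thesis using limI[OF assms] by (simp add: W_def)
qed

text \<open>
  On a surviving path with eventually calm noise the probabilistic part is over, and the linear
  theory applies to the realised births.
\<close>

lemma surviving_path:
  assumes calm: "\<exists>N. \<forall>n\<ge>N. calm n \<omega>" and surv: "\<And>n. Z n \<omega> > 0"
  shows "(\<lambda>n. real (Z n \<omega>) / mean_size n) \<longlonglongrightarrow> W \<omega>" "W \<omega> > 0"
    "(\<lambda>n. births \<omega> (n - k) / real (Z n \<omega>)) \<longlonglongrightarrow> m / (m + 1) ^ (k + 1)"
proof -
  obtain N where N: "\<And>n. N \<le> n \<Longrightarrow> calm n \<omega>" using calm by blast
  have ge1: "1 \<le> alive a (births \<omega>) n" for n
    using surv[of n] unfolding Z_alive[symmetric] by simp
  have calm': "4 * (births \<omega> (Suc n) - m * alive a (births \<omega>) n)\<^sup>2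
      \<le> m\<^sup>2 * alive a (births \<omega>) n * sqrt (alive a (births \<omega>) n)" if "N \<le> n" for n
    using N[OF that] unfolding calm_def noise_Suc Z_alive .
  obtain C \<theta> where C: "C \<ge> 0" "0 \<le> \<theta>" "\<theta> < 1"
    and err: "\<And>n. \<bar>births \<omega> (Suc n) - m * alive a (births \<omega>) n\<bar> \<le> C * \<theta> ^ n * alive a (births \<omega>) n"
    using calm_error_decay[OF births_nonneg ge1 calm'] by blast
  have pos: "0 < alive a (births \<omega>) n" for n using ge1[of n] by linarith
  have "\<bar>births \<omega> (Suc n) - m * alive a (births \<omega>) n\<bar>
      \<le> C * \<theta> ^ n * (\<bar>alive a (births \<omega>) n\<bar> + mean_size n)" for n
  proof -
    have "C * \<theta> ^ n * alive a (births \<omega>) n \<le> C * \<theta> ^ n * (\<bar>alive a (births \<omega>) n\<bar> + mean_size n)"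
      using C mean_size_pos[of n] by (intro mult_left_mono) auto
    then show ?thesis using err[of n] by linarith
  qed
  then have "convergent (\<lambda>n. alive a (births \<omega>) n / mean_size n)"
    by (rule ratio_converges[OF C])
  then obtain w where w: "(\<lambda>n. alive a (births \<omega>) n / mean_size n) \<longlonglongrightarrow> w"
    by (auto simp: convergent_def)
  have wW: "W \<omega> = w" by (rule W_eq_limit) (use w in \<open>simp add: Z_alive\<close>)
  then show lim: "(\<lambda>n. real (Z n \<omega>) / mean_size n) \<longlonglongrightarrow> W \<omega>" using w by (simp add: Z_alive)
  have wpos: "w > 0" by (rule ratio_positive[OF C births_nonneg pos err w])
  then show "W \<omega> > 0" using wW by simp
  show "(\<lambda>n. births \<omega> (n - k) / real (Z n \<omega>)) \<longlonglongrightarrow> m / (m + 1) ^ (k + 1)"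
    unfolding Z_alive by (rule age_fraction_tendsto[OF C pos err w wpos])
qed

lemma extinct_path:
  assumes "Z k \<omega> = 0"
  shows "(\<lambda>n. real (Z n \<omega>) / mean_size n) \<longlonglongrightarrow> W \<omega>" "W \<omega> = 0"
proof -
  have "\<forall>\<^sub>F n in sequentially. real (Z n \<omega>) / mean_size n = 0"
    using eventually_ge_at_top[of k] by eventually_elim (simp add: Z_absorbing[OF assms])
  then have "(\<lambda>n. real (Z n \<omega>) / mean_size n) \<longlonglongrightarrow> 0" by (rule tendsto_eventually)
  then show "W \<omega> = 0" "(\<lambda>n. real (Z n \<omega>) / mean_size n) \<longlonglongrightarrow> W \<omega>"
    using W_eq_limit by auto
qed

lemma AE_ratio_tendsto: "AE \<omega> in M. (\<lambda>n. real (Z n \<omega>) / mean_size n) \<longlonglongrightarrow> W \<omega>"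
  using AE_eventually_calm
proof eventually_elim
  case (elim \<omega>)
  show ?case
  proof (cases "\<exists>k. Z k \<omega> = 0")
    case True
    then show ?thesis using extinct_path by blast
  next
    case False
    then show ?thesis using surviving_path(1)[OF elim] by simp
  qed
qed

text \<open>
  The distance between the ratios at times \<open>n\<close> and \<open>k\<close> is bounded in quadratic mean by \<open>spread\<close>;
  Fatou's lemma along \<open>k\<close> turns this into a bound for the distance to the almost sure limit.
\<close>

lemma W_L2:
  shows "integrable M (\<lambda>\<omega>. (real (Z n \<omega>) / mean_size n - W \<omega>)\<^sup>2)"
    and "expectation (\<lambda>\<omega>. (real (Z n \<omega>) / mean_size n - W \<omega>)\<^sup>2) \<le> 2 * s2 * spread n"
proof -
  define Y where "Y k \<omega> = real (Z k \<omega>) / mean_size k" for k \<omega>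
  have [measurable]: "Y k \<in> borel_measurable M" for k unfolding Y_def[abs_def] by measurable
  have spread_nonneg: "0 \<le> spread k" for k
    unfolding spread_def using mean_size_pos by (intro suminf_nonneg spread_summable) (auto simp: less_imp_le)
  have "(\<integral>\<^sup>+\<omega>. ennreal ((Y n \<omega> - W \<omega>)\<^sup>2) \<partial>M) = (\<integral>\<^sup>+\<omega>. liminf (\<lambda>k. ennreal ((Y n \<omega> - Y k \<omega>)\<^sup>2)) \<partial>M)"
  proof (rule nn_integral_cong_AE)
    show "AE \<omega> in M. ennreal ((Y n \<omega> - W \<omega>)\<^sup>2) = liminf (\<lambda>k. ennreal ((Y n \<omega> - Y k \<omega>)\<^sup>2))"
      using AE_ratio_tendsto
    proof eventually_elim
      case (elim \<omega>)
      then have "(\<lambda>k. ennreal ((Y n \<omega> - Y k \<omega>)\<^sup>2)) \<longlonglongrightarrow> ennreal ((Y n \<omega> - W \<omega>)\<^sup>2)"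
        unfolding Y_def by (intro tendsto_intros tendsto_ennrealI)
      then show ?case by (intro lim_imp_Liminf[symmetric]) auto
    qed
  qed
  also have "\<dots> \<le> liminf (\<lambda>k. \<integral>\<^sup>+\<omega>. ennreal ((Y n \<omega> - Y k \<omega>)\<^sup>2) \<partial>M)"
    by (intro nn_integral_liminf) auto
  also have "\<dots> \<le> liminf (\<lambda>k. ennreal (s2 * (2 * spread n + 2 * spread k)))"
  proof (intro Liminf_mono always_eventually allI)
    fix k
    have "(\<integral>\<^sup>+\<omega>. ennreal ((Y n \<omega> - Y k \<omega>)\<^sup>2) \<partial>M) = ennreal (expectation (\<lambda>\<omega>. (Y n \<omega> - Y k \<omega>)\<^sup>2))"
      using ratio_difference_L2(1)[of n k] by (intro nn_integral_eq_integral) (auto simp: Y_def)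
    also have "\<dots> \<le> ennreal (s2 * (2 * spread n + 2 * spread k))"
      using ratio_difference_L2(2)[of n k] by (intro ennreal_leI) (simp add: Y_def)
    finally show "(\<integral>\<^sup>+\<omega>. ennreal ((Y n \<omega> - Y k \<omega>)\<^sup>2) \<partial>M) \<le> ennreal (s2 * (2 * spread n + 2 * spread k))" .
  qed
  also have "\<dots> = ennreal (s2 * (2 * spread n + 2 * 0))"
    by (intro lim_imp_Liminf tendsto_ennrealI tendsto_intros spread_tendsto) simp
  finally have le: "(\<integral>\<^sup>+\<omega>. ennreal ((Y n \<omega> - W \<omega>)\<^sup>2) \<partial>M) \<le> ennreal (2 * s2 * spread n)"
    by (simp add: mult_ac)
  have int: "integrable M (\<lambda>\<omega>. (Y n \<omega> - W \<omega>)\<^sup>2)"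
  proof (rule integrableI_nonneg)
    show "(\<integral>\<^sup>+\<omega>. ennreal ((Y n \<omega> - W \<omega>)\<^sup>2) \<partial>M) < \<infinity>"
      using le by (rule order_le_less_trans) simp
  qed auto
  then show "integrable M (\<lambda>\<omega>. (real (Z n \<omega>) / mean_size n - W \<omega>)\<^sup>2)" by (simp add: Y_def)
  have "ennreal (expectation (\<lambda>\<omega>. (Y n \<omega> - W \<omega>)\<^sup>2)) \<le> ennreal (2 * s2 * spread n)"
    using le int by (subst nn_integral_eq_integral[symmetric]) auto
  then have "expectation (\<lambda>\<omega>. (Y n \<omega> - W \<omega>)\<^sup>2) \<le> 2 * s2 * spread n"
    using s2_nonneg spread_nonneg by (subst (asm) ennreal_le_iff) auto
  then show "expectation (\<lambda>\<omega>. (real (Z n \<omega>) / mean_size n - W \<omega>)\<^sup>2) \<le> 2 * s2 * spread n"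
    by (simp add: Y_def)
qed

lemma W_sq_integrable: "integrable M (\<lambda>\<omega>. (W \<omega>)\<^sup>2)"
proof -
  have "integrable M (\<lambda>\<omega>. (1 - W \<omega>)\<^sup>2)"
    using W_L2(1)[of 0] by (simp add: mean_size_def alive_def)
  then have "integrable M (\<lambda>\<omega>. (- 1 + (1 - W \<omega>))\<^sup>2)"
    by (intro square_sum_integrable) auto
  then show ?thesis by simp
qed

lemma ratio_converges_L2: "converges_L2 M (\<lambda>n \<omega>. real (Z n \<omega>) / mean_size n) W"
  unfolding converges_L2_def
proof (intro conjI allI)
  fix n
  show "integrable M (\<lambda>\<omega>. (real (Z n \<omega>) / mean_size n)\<^sup>2)"
    using Z_sq_integrable[of n] by (simp add: power_divide)
  show "(\<lambda>n. expectation (\<lambda>\<omega>. (real (Z n \<omega>) / mean_size n - W \<omega>)\<^sup>2)) \<longlonglongrightarrow> 0"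
  proof (rule tendsto_sandwich[OF _ _ tendsto_const])
    show "\<forall>\<^sub>F n in sequentially. expectation (\<lambda>\<omega>. (real (Z n \<omega>) / mean_size n - W \<omega>)\<^sup>2) \<le> 2 * s2 * spread n"
      using W_L2(2) by simp
    show "(\<lambda>n. 2 * s2 * spread n) \<longlonglongrightarrow> 0"
      using tendsto_mult[OF tendsto_const[of "2 * s2"] spread_tendsto] by simp
  qed simp
qed (use W_sq_integrable in auto)

text \<open>
  If \<open>W\<close> vanished almost surely then the ratios, which have mean one and hence second moment at
  least one, would tend to \<open>0\<close> in quadratic mean.
\<close>

lemma prob_W_pos: "prob {\<omega> \<in> space M. W \<omega> > 0} > 0"
proof (rule ccontr)
  assume "\<not> prob {\<omega> \<in> space M. W \<omega> > 0} > 0"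
  then have "prob {\<omega> \<in> space M. W \<omega> > 0} = 0" using measure_nonneg[of M] by (simp add: not_less antisym)
  then have "AE \<omega> in M. \<not> W \<omega> > 0"
    by (subst (asm) prob_eq_0) auto
  then have W0: "AE \<omega> in M. W \<omega> = 0"
    by eventually_elim (use W_nonneg in \<open>auto simp: not_less intro: antisym\<close>)
  have "1 \<le> expectation (\<lambda>\<omega>. (real (Z n \<omega>) / mean_size n - W \<omega>)\<^sup>2)" for n
  proof -
    have int: "integrable M (\<lambda>\<omega>. real (Z n \<omega>) / mean_size n)" "integrable M (\<lambda>\<omega>. (real (Z n \<omega>) / mean_size n)\<^sup>2)"
      using Z_integrable[of n] Z_sq_integrable[of n] by (simp_all add: power_divide)
    have E: "expectation (\<lambda>\<omega>. real (Z n \<omega>) / mean_size n) = 1"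
      using expectation_Z[of n] mean_size_pos[of n] by simp
    have "0 \<le> expectation (\<lambda>\<omega>. (real (Z n \<omega>) / mean_size n - 1)\<^sup>2)" by simp
    also have "\<dots> = expectation (\<lambda>\<omega>. (real (Z n \<omega>) / mean_size n)\<^sup>2) - 1"
    proof -
      have "expectation (\<lambda>\<omega>. (Y \<omega> - 1)\<^sup>2) = expectation (\<lambda>\<omega>. (Y \<omega>)\<^sup>2) - 1"
        if "integrable M Y" "integrable M (\<lambda>\<omega>. (Y \<omega>)\<^sup>2)" "expectation Y = 1" for Y :: "'w \<Rightarrow> real"
        using that by (simp add: power2_diff prob_space)
      from this[OF int E] show ?thesis .
    qed
    also have "expectation (\<lambda>\<omega>. (real (Z n \<omega>) / mean_size n)\<^sup>2) = expectation (\<lambda>\<omega>. (real (Z n \<omega>) / mean_size n - W \<omega>)\<^sup>2)"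
      by (rule integral_cong_AE) (use W0 in auto)
    finally show ?thesis by simp
  qed
  moreover have "(\<lambda>n. expectation (\<lambda>\<omega>. (real (Z n \<omega>) / mean_size n - W \<omega>)\<^sup>2)) \<longlonglongrightarrow> 0"
    using ratio_converges_L2 by (simp add: converges_L2_def)
  ultimately have "(1::real) \<le> 0" by (intro LIMSEQ_le_const) auto
  then show False by simp
qed

lemma Nonext_eq: "Nonext M a X = {\<omega> \<in> space M. \<forall>n. Z n \<omega> > 0}"
  by (simp add: Nonext_def Z_def)

lemma Nonext_event: "Nonext M a X \<in> events"
  unfolding Nonext_eq by measurable

text \<open>
  Extinction is permanent and forces \<open>W = 0\<close>.
\<close>

lemma prob_Nonext_pos: "prob (Nonext M a X) > 0"
proof -
  have "{\<omega> \<in> space M. W \<omega> > 0} \<subseteq> Nonext M a X"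
    unfolding Nonext_eq using extinct_path(2) by (auto intro!: gr0I)
  then have "prob {\<omega> \<in> space M. W \<omega> > 0} \<le> prob (Nonext M a X)"
    using Nonext_event by (intro finite_measure_mono)
  then show ?thesis using prob_W_pos by linarith
qed

lemma AE_W_pos: "AE \<omega> in M. \<omega> \<in> Nonext M a X \<longrightarrow> W \<omega> > 0"
  using AE_eventually_calm
  by eventually_elim (auto simp: Nonext_eq intro: surviving_path(2))

lemma AE_age_fraction:
  "AE \<omega> in M. \<omega> \<in> Nonext M a X \<longrightarrow>
     (\<lambda>n. real (aging_Z_age a X n k \<omega>) / real (Z n \<omega>)) \<longlonglongrightarrow> m / (m + 1) ^ (k + 1)"
  using AE_eventually_calm
proof eventually_elim
  case (elim \<omega>)
  show ?case
  proof
    assume "\<omega> \<in> Nonext M a X"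
    then have lim: "(\<lambda>n. births \<omega> (n - k) / real (Z n \<omega>)) \<longlonglongrightarrow> m / (m + 1) ^ (k + 1)"
      using elim by (intro surviving_path(3)) (auto simp: Nonext_eq)
    obtain n0 where n0: "\<And>n. n \<ge> n0 \<Longrightarrow> k \<le> a n" using eventually_age_ge by blast
    have "\<forall>\<^sub>F n in sequentially. births \<omega> (n - k) / real (Z n \<omega>)
        = real (aging_Z_age a X n k \<omega>) / real (Z n \<omega>)"
      using eventually_ge_at_top[of "max n0 k"]
    proof eventually_elim
      case (elim n)
      then have "k \<le> a n \<and> k \<le> n" using n0 by auto
      then show ?case
        using aging_age_conv_births[of a "\<lambda>j i. X j i \<omega>" n k, OF age_step]
        by (simp add: births_def aging_Z_age_def)
    qed
    then show "(\<lambda>n. real (aging_Z_age a X n k \<omega>) / real (Z n \<omega>)) \<longlonglongrightarrow> m / (m + 1) ^ (k + 1)"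
      using lim by (rule Lim_transform_eventually[rotated])
  qed
qed

end

theorem theorem1:
  fixes M :: "'w measure" and N :: "'v measure"
    and R :: "'v \<Rightarrow> nat" and X :: "nat \<Rightarrow> nat \<Rightarrow> 'w \<Rightarrow> nat"
    and a :: "nat \<Rightarrow> nat" and m :: real
  assumes "prob_space M" and "prob_space N"
    and a_step: "\<And>n. a n \<le> a (Suc n) \<and> a (Suc n) \<le> a n + 1"
    and a_lim: "filterlim a at_top sequentially"
    and R_rv: "R \<in> measurable N (count_space UNIV)"
    and R_int: "integrable N (\<lambda>x. real (R x))"
    and m_def: "m = (\<integral>x. real (R x) \<partial>N)"
    and m_pos: "m > 0"
    and R_var: "integrable N (\<lambda>x. (real (R x) - m)\<^sup>2)"
    and X_indep: "prob_space.indep_vars M (\<lambda>_. count_space UNIV) (\<lambda>(j, n). X j n) ({1..} \<times> {1..})"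
    and X_copies: "\<And>j n. j \<ge> 1 \<Longrightarrow> n \<ge> 1 \<Longrightarrow>
      distr M (count_space UNIV) (X j n) = distr N (count_space UNIV) R"
  shows "(Nonext M a X \<in> sets M \<and> measure M (Nonext M a X) > 0) \<and>
    (\<exists>W. W \<in> borel_measurable M \<and> (\<forall>\<omega> \<in> space M. W \<omega> \<ge> 0) \<and>
      (AE \<omega> in M. (\<lambda>n. real (aging_Z a X n \<omega>) / (\<integral>\<omega>'. real (aging_Z a X n \<omega>') \<partial>M)) \<longlonglongrightarrow> W \<omega>) \<and>
      converges_L2 M (\<lambda>n \<omega>. real (aging_Z a X n \<omega>) / (\<integral>\<omega>'. real (aging_Z a X n \<omega>') \<partial>M)) W \<and>
      (AE \<omega> in M. \<omega> \<in> Nonext M a X \<longrightarrow> W \<omega> > 0)) \<and>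
    (\<forall>k. AE \<omega> in M. \<omega> \<in> Nonext M a X \<longrightarrow>
      (\<lambda>n. real (aging_Z_age a X n k \<omega>) / real (aging_Z a X n \<omega>)) \<longlonglongrightarrow> m / (m + 1) ^ (k + 1))"
proof -
  interpret M: prob_space M by fact
  interpret N: prob_space N by fact
  define s2 where "s2 = (\<integral>x. (real (R x) - m)\<^sup>2 \<partial>N)"
  define p where "p = N.prob {x \<in> space N. R x \<ge> 1}"
  have Xm: "X j n \<in> measurable M (count_space UNIV)" if "j \<ge> 1" "n \<ge> 1" for j n
  proof -
    have "\<forall>i\<in>{1..} \<times> {1..}. (case i of (j, n) \<Rightarrow> X j n) \<in> measurable M (count_space UNIV)"
      using X_indep unfolding M.indep_vars_def by (rule conjunct1)
    from bspec[OF this, of "(j, n)"] that show ?thesis by simp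
  qed
  have transfer: "integrable M (\<lambda>\<omega>. f (X j n \<omega>)) \<longleftrightarrow> integrable N (\<lambda>x. f (R x))"
    "M.expectation (\<lambda>\<omega>. f (X j n \<omega>)) = (\<integral>x. f (R x) \<partial>N)"
    if "j \<ge> 1" "n \<ge> 1" for j n and f :: "nat \<Rightarrow> real"
    using integrable_distr_eq[OF Xm[OF that], of f] integrable_distr_eq[OF R_rv, of f]
      integral_distr[OF Xm[OF that], of f] integral_distr[OF R_rv, of f] X_copies[OF that]
    by simp_all
  have ppos: "p > 0"
  proof (rule ccontr)
    assume "\<not> p > 0"
    then have "p = 0" using measure_nonneg[of N "{x \<in> space N. R x \<ge> 1}"] by (simp add: p_def not_less antisym)
    moreover have "{x \<in> space N. R x \<ge> 1} \<in> N.events"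
      using measurable_sets[OF R_rv, of "{1..}"] by (simp add: vimage_def Int_def conj_commute)
    ultimately have "AE x in N. \<not> R x \<ge> 1"
      by (simp add: p_def N.prob_eq_0)
    then have "AE x in N. real (R x) = 0" by eventually_elim simp
    then have "(\<integral>x. real (R x) \<partial>N) = 0" by (rule integral_eq_zero_AE)
    then show False using m_pos m_def by simp
  qed
  interpret aging_process M a m X s2 p
  proof unfold_locales
    show "M.indep_vars (\<lambda>_. count_space UNIV) (\<lambda>(j, n). X j n) ({1..} \<times> {1..})" by fact
    fix j n :: nat assume jn: "j \<ge> 1" "n \<ge> 1"
    show "integrable M (\<lambda>\<omega>. real (X j n \<omega>)) \<and> M.expectation (\<lambda>\<omega>. real (X j n \<omega>)) = m"
      using transfer[OF jn, of real] R_int m_def by simp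
    show "integrable M (\<lambda>\<omega>. (real (X j n \<omega>) - m)\<^sup>2) \<and> M.expectation (\<lambda>\<omega>. (real (X j n \<omega>) - m)\<^sup>2) = s2"
      using transfer[OF jn, of "\<lambda>x. (real x - m)\<^sup>2"] R_var s2_def by simp
    have "M.prob {\<omega> \<in> space M. X j n \<omega> \<ge> 1} = measure (distr M (count_space UNIV) (X j n)) {1..}"
      using Xm[OF jn] by (subst measure_distr) (auto intro!: arg_cong[where f = M.prob])
    also have "\<dots> = p"
      unfolding X_copies[OF jn] p_def
      using R_rv by (subst measure_distr) (auto intro!: arg_cong[where f = N.prob])
    finally show "M.prob {\<omega> \<in> space M. X j n \<omega> \<ge> 1} = p" .
  qed (use a_step a_lim m_pos ppos in auto)
  have Z: "aging_Z a X n \<omega> = Z n \<omega>" for n \<omega> by (simp add: Z_def)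
  show ?thesis
    unfolding Z expectation_Z
    by (intro conjI exI[of _ W] allI ballI Nonext_event prob_Nonext_pos W_rv W_nonneg
        AE_ratio_tendsto ratio_converges_L2 AE_W_pos AE_age_fraction)
qed

end
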